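(* Let $\mathcal{M}=(S,\mathcal{A},\mathcal{P},s_0)$ be a finite MDP with a (non-empty) set $W\subseteq S$ of observed states and let $\pi\in\Pi^{St}(\mathcal{M})$ be a stationary policy. For each $w\in W$ let $\sigma_w$ be the mean squared error of an unbiased estimator of the transition probabilities $(\mathcal{P}^{\pi}_{w,q})_{q\in Succ(w)}$ at $w$, where the observed data are the whole path of the agent and the transition probabilities at all states in $S\setminus\{w\}$ are known. Then the total mean squared error satisfies $$\sum_{w\in W}\sigma_w\ \ge\ \frac{\min_{w\in W}\Pr^{\pi}(Reach[w])^2\;|W|^2}{\mathbb{E}[\iota^{\pi}_{W,\xi}]},$$ where $\xi$ is a random path generated under $\pi$. Consequently, if $\Pr^{\pi}(Reach[w])=1$ for every $\pi\in\Pi^{St}(\mathcal{M})$ and all $w\in W$, then $\dfrac{|W|^2}{\mathbb{E}[\iota^{\pi}_{W,\xi}]}$ is a lower bound on the total mean squared error $\sum_{w\in W}\sigma_w$.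
   Context: An MDP has finite state set $S$, finite action set $\mathcal{A}$, available actions $\mathcal{A}(s)$, transition probabilities $\mathcal{P}_{s,a,q}$ with $\sum_q\mathcal{P}_{s,a,q}=1$ for $a\in\mathcal{A}(s)$, and initial state $s_0$. $Succ(s)=\{q:\exists a\in\mathcal{A}(s),\ \mathcal{P}_{s,a,q}>0\}$. A stationary policy $\pi\in\Pi^{St}(\mathcal{M})$ assigns to each $s$ a distribution $(\pi_{s,a})_{a\in\mathcal{A}(s)}$ and induces a Markov chain from $s_0$ with transition probabilities $\mathcal{P}^{\pi}_{s,q}=\sum_a\pi_{s,a}\mathcal{P}_{s,a,q}$. $\Pr^{\pi}(Reach[w])$ is the probability that the random path $\xi=s_0s_1\ldots$ ever visits $w$. The transition information is $\iota^{\pi}_s=\big(\sum_{q\in Succ(s)}\mathcal{P}^{\pi}_{s,q}(1-\mathcal{P}^{\pi}_{s,q})\big)^{-1}\in(0,\infty]$ ($\infty$ if the sum is $0$), and the total information of a path is $\iota^{\pi}_{W,\xi}=\sum_{t\ge0}\mathds{1}_W(s_t)\,\iota^{\pi}_{s_t}$ (terms with $s_t\notin W$ are $0$). Estimation setting at $w$: the unknown parameter is the transition distribution $\theta=(\theta_q)_{q\in Succ(w)}$ at $w$, with true value $\theta=\mathcal{P}^\pi_w$. For each probability vector $\theta$ on $Succ(w)$, consider the Markov chain from $s_0$ with transition distribution $\theta$ at $w$ and the known distributions $\mathcal{P}^{\pi}_{s,\cdot}$ at $s\neq w$. An estimator is a measurable function $\hat\theta$ of the whole infinite path $\xi$ with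 values in $\mathbb{R}^{Succ(w)}$; it is unbiased if $\mathbb{E}_\theta[\hat\theta]=\theta$ for all such $\theta$. Its mean squared error is $\sigma_w=\sum_{q\in Succ(w)}\mathbb{E}\big[(\hat\theta_q-\mathcal{P}^{\pi}_{w,q})^2\big]$, expectation under $\theta=\mathcal{P}^{\pi}_w$. Conventions: a quotient with infinite denominator is $0$ (the Cramér–Rao lower bound is taken to be zero when the Fisher information is infinite); the quotient $0/0$ (arising when no observed state is reachable) is read as $0$. *)

theory Defs
  imports "HOL-Probability.Probability"
begin

section \<open>Markov decision processes and stationary policies\<close>

text \<open>
  The transition distribution \<open>trans M s a\<close> is a probability mass function, so that
  \<open>pmf (trans M s a) q\<close> is the probability of moving from \<open>s\<close> to \<open>q\<close> under \<open>a\<close>. Its values at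
  unavailable actions are never used. Every state has an available action
  as soon as there is a stationary policy at all.
\<close>

record ('s, 'a) mdp =
  actions :: "'s \<Rightarrow> 'a set"
  trans :: "'s \<Rightarrow> 'a \<Rightarrow> 's pmf"
  init :: 's

definition succ_states :: "('s, 'a) mdp \<Rightarrow> 's \<Rightarrow> 's set" where
  "succ_states M s = {q. \<exists>a\<in>actions M s. 0 < pmf (trans M s a) q}"

definition stationary_policies :: "('s, 'a) mdp \<Rightarrow> ('s \<Rightarrow> 'a pmf) set" where
  "stationary_policies M = {\<pi>. \<forall>s. set_pmf (\<pi> s) \<subseteq> actions M s}"

definition induced :: "('s, 'a) mdp \<Rightarrow> ('s \<Rightarrow> 'a pmf) \<Rightarrow> 's \<Rightarrow> 's pmf" where
  "induced M \<pi> s = bind_pmf (\<pi> s) (trans M s)"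

lemma pmf_induced:
  fixes M :: "('s, 'a::finite) mdp"
  assumes "\<pi> \<in> stationary_policies M"
  shows "pmf (induced M \<pi> s) q = (\<Sum>a\<in>actions M s. pmf (\<pi> s) a * pmf (trans M s a) q)"
  using assms unfolding induced_def pmf_bind stationary_policies_def
  by (subst integral_measure_pmf_real[of "actions M s"]) (auto simp: mult.commute)

lemma set_pmf_induced:
  assumes "\<pi> \<in> stationary_policies M"
  shows "set_pmf (induced M \<pi> s) \<subseteq> succ_states M s"
  using assms
  by (auto simp: induced_def stationary_policies_def succ_states_def intro!: bexI pmf_positive)


section \<open>The law of a Markov chain on infinite paths\<close>

abbreviation path_space :: "(nat \<Rightarrow> 's) measure" where
  "path_space \<equiv> PiM UNIV (\<lambda>_. count_space UNIV)"

definition step_law :: "('s \<Rightarrow> 's pmf) \<Rightarrow> 's \<Rightarrow> nat \<Rightarrow> (nat \<Rightarrow> 's) \<Rightarrow> 's pmf" where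
  "step_law K s i \<xi> = (case i of 0 \<Rightarrow> return_pmf s | Suc j \<Rightarrow> K (\<xi> j))"

text \<open>
  The Ionescu-Tulcea extension of the kernels above; \<open>emeasure_path_law_cylinder\<close> below confirms
  that it is the law of the Markov chain with transition kernel \<open>K\<close> started in \<open>s\<close>.
\<close>

definition path_law :: "('s \<Rightarrow> 's pmf) \<Rightarrow> 's \<Rightarrow> (nat \<Rightarrow> 's) measure" where
  "path_law K s =
     projective_family.lim UNIV
       (Ionescu_Tulcea.CI (\<lambda>i \<xi>. measure_pmf (step_law K s i \<xi>)) (\<lambda>_. count_space UNIV))
       (\<lambda>_. count_space UNIV)"

lemma Ionescu_Tulcea_step_law:
  "Ionescu_Tulcea (\<lambda>i \<xi>. measure_pmf (step_law K s i \<xi>)) (\<lambda>_. count_space UNIV)"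
proof
  fix i :: nat
  show "(\<lambda>\<xi>. measure_pmf (step_law K s i \<xi>))
      \<in> measurable (PiM {0..<i} (\<lambda>_. count_space UNIV)) (subprob_algebra (count_space UNIV))"
  proof (cases i)
    case 0
    then show ?thesis
      by (simp add: step_law_def space_subprob_algebra prob_space_imp_subprob_space
          measure_pmf.prob_space_axioms)
  next
    case (Suc j)
    have "(\<lambda>\<xi>. \<xi> j) \<in> measurable (PiM {0..<i} (\<lambda>_. count_space UNIV)) (count_space UNIV)"
      using Suc by (intro measurable_component_singleton) auto
    moreover have "(\<lambda>x. measure_pmf (K x))
        \<in> measurable (count_space UNIV) (subprob_algebra (count_space UNIV))"
      by (simp add: space_subprob_algebra prob_space_imp_subprob_space
          measure_pmf.prob_space_axioms)
    ultimately show ?thesis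
      unfolding step_law_def Suc by (auto intro: measurable_compose)
  qed
qed

context
  fixes K :: "'s \<Rightarrow> 's pmf" and s :: 's
begin

interpretation IT: Ionescu_Tulcea "\<lambda>i \<xi>. measure_pmf (step_law K s i \<xi>)" "\<lambda>_. count_space UNIV"
  by (rule Ionescu_Tulcea_step_law)

lemma sets_path_law [simp, measurable_cong]: "sets (path_law K s) = sets path_space"
  by (simp add: path_law_def)

lemma space_path_law [simp]: "space (path_law K s) = UNIV"
  by (simp add: path_law_def space_PiM)

lemma prob_space_path_law: "prob_space (path_law K s)"
proof
  have "emeasure IT.PF.lim (prod_emb UNIV (\<lambda>_. count_space UNIV) {} (space (PiM {} (\<lambda>_. count_space UNIV))))
      = emeasure (IT.CI {}) (space (PiM {} (\<lambda>_. count_space UNIV)))"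
    by (rule IT.lim) auto
  also have "\<dots> = 1"
    using IT.PF.prob_space_P[of "{}"] IT.PF.space_P[of "{}"]
    by (metis empty_subsetI finite.emptyI prob_space.emeasure_space_1)
  finally show "emeasure (path_law K s) (space (path_law K s)) = 1"
    by (simp add: path_law_def prod_emb_def space_PiM vimage_def restrict_def)
qed

lemma emeasure_path_law_cylinder:
  "emeasure (path_law K s) {\<xi>. \<forall>i\<le>n. \<xi> i = x i} =
     ennreal ((if x 0 = s then 1 else 0) * (\<Prod>i<n. pmf (K (x i)) (x (Suc i))))"
proof -
  let ?M = "\<lambda>_::nat. count_space (UNIV :: 's set)"
  have sing: "{restrict x {0..<m}} \<in> sets (PiM {0..<m} ?M)" for m :: nat
  proof -
    have "{restrict x {0..<m}} = PiE {0..<m} (\<lambda>i. {x i})"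
      by (auto simp: PiE_iff extensional_def fun_eq_iff)
    then show ?thesis by (simp add: sets_PiM_I_finite)
  qed
  have C: "emeasure (IT.C 0 m (\<lambda>_. undefined)) {restrict x {0..<m}} =
      ennreal (\<Prod>i<m. pmf (step_law K s i x) (x i))" for m
  proof (induction m)
    case 0
    have "(\<lambda>_. undefined) = restrict x {0..<0::nat}" by (auto simp: fun_eq_iff)
    then show ?case using sing[of 0] by (simp add: one_ennreal_def)
  next
    case (Suc m)
    let ?C = "IT.C 0 m (\<lambda>_. undefined)"
    have sp: "space ?C = space (PiM {0..<m} ?M)" using IT.space_C[of "\<lambda>_. undefined" 0 m] by simp
    have st: "sets ?C = sets (PiM {0..<m} ?M)" using IT.sets_C[of "\<lambda>_. undefined" 0 m] by simp
    have ne: "space ?C \<noteq> {}" unfolding sp by (auto simp: space_PiM PiE_eq_empty_iff)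
    have eP: "IT.eP m \<in> measurable ?C (subprob_algebra (PiM {0..<Suc m} ?M))"
      using IT.measurable_eP[of m] st by (simp cong: measurable_cong_sets)
    have e: "emeasure (IT.eP m \<xi>) {restrict x {0..<Suc m}} =
        ennreal (pmf (step_law K s m x) (x m)) * indicator {restrict x {0..<m}} \<xi>"
      if \<xi>: "\<xi> \<in> space (PiM {0..<m} ?M)" for \<xi>
    proof -
      have "\<xi> \<in> extensional {0..<m}" using \<xi> by (auto simp: space_PiM PiE_iff)
      then have iff: "\<xi>(m := y) = restrict x {0..<Suc m} \<longleftrightarrow> \<xi> = restrict x {0..<m} \<and> y = x m" for y
        unfolding fun_eq_iff extensional_def restrict_def
        by (auto simp: less_Suc_eq)
      have "emeasure (IT.eP m \<xi>) {restrict x {0..<Suc m}} =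
          emeasure (measure_pmf (step_law K s m \<xi>)) ((\<lambda>y. \<xi>(m := y)) -` {restrict x {0..<Suc m}})"
        using IT.emeasure_eP[OF \<xi> sing[of "Suc m"]] by simp
      also have "(\<lambda>y. \<xi>(m := y)) -` {restrict x {0..<Suc m}} =
          (if \<xi> = restrict x {0..<m} then {x m} else {})"
        by (intro set_eqI, unfold vimage_singleton_eq iff) simp
      also have "emeasure (measure_pmf (step_law K s m \<xi>)) (if \<xi> = restrict x {0..<m} then {x m} else {}) =
          ennreal (pmf (step_law K s m x) (x m)) * indicator {restrict x {0..<m}} \<xi>"
      proof -
        have "step_law K s m (restrict x {0..<m}) = step_law K s m x"
          by (simp add: step_law_def split: nat.split)
        then show ?thesis by (simp add: emeasure_pmf_single)
      qed
      finally show ?thesis .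
    qed
    have "emeasure (IT.C 0 (Suc m) (\<lambda>_. undefined)) {restrict x {0..<Suc m}} =
        (\<integral>\<^sup>+\<xi>. emeasure (IT.eP m \<xi>) {restrict x {0..<Suc m}} \<partial>?C)"
      using emeasure_bind[OF ne eP sing] by simp
    also have "\<dots> = (\<integral>\<^sup>+\<xi>. ennreal (pmf (step_law K s m x) (x m)) * indicator {restrict x {0..<m}} \<xi> \<partial>?C)"
      by (intro nn_integral_cong e) (simp add: sp)
    also have "\<dots> = ennreal (pmf (step_law K s m x) (x m)) * emeasure ?C {restrict x {0..<m}}"
      using sing[of m] st by (intro nn_integral_cmult_indicator) auto
    also have "\<dots> = ennreal (\<Prod>i<Suc m. pmf (step_law K s i x) (x i))"
      unfolding Suc.IH by (simp add: ennreal_mult' mult.commute prod_nonneg)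
    finally show ?case .
  qed
  have "{\<xi>. \<forall>i\<le>n. \<xi> i = x i} = prod_emb UNIV ?M {0..<Suc n} {restrict x {0..<Suc n}}"
    by (auto simp: prod_emb_def space_PiM fun_eq_iff restrict_def less_Suc_eq_le) metis
  then have "emeasure (path_law K s) {\<xi>. \<forall>i\<le>n. \<xi> i = x i} =
      emeasure (IT.CI {0..<Suc n}) {restrict x {0..<Suc n}}"
    using IT.lim[OF _ sing[of "Suc n"]] by (simp add: path_law_def)
  also have "\<dots> = emeasure (IT.C 0 (Suc n) (\<lambda>_. undefined))
      (prod_emb {0..<Suc n} ?M {0..<Suc n} {restrict x {0..<Suc n}})"
    by (rule IT.emeasure_CI) (use sing[of "Suc n"] in auto)
  also have "prod_emb {0..<Suc n} ?M {0..<Suc n} {restrict x {0..<Suc n}} = {restrict x {0..<Suc n}}"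
    by (rule prod_emb_id) (auto simp: PiE_iff)
  also have "emeasure (IT.C 0 (Suc n) (\<lambda>_. undefined)) {restrict x {0..<Suc n}} =
      ennreal (\<Prod>i<Suc n. pmf (step_law K s i x) (x i))"
    by (rule C)
  also have "(\<Prod>i<Suc n. pmf (step_law K s i x) (x i)) =
      (if x 0 = s then 1 else 0) * (\<Prod>i<n. pmf (K (x i)) (x (Suc i)))"
    by (subst prod.lessThan_Suc_shift) (auto simp: step_law_def)
  finally show ?thesis .
qed

end


section \<open>Reachability and transition information\<close>

definition reach_prob :: "('s, 'a) mdp \<Rightarrow> ('s \<Rightarrow> 'a pmf) \<Rightarrow> 's \<Rightarrow> real" where
  "reach_prob M \<pi> w = \<P>(\<xi> in path_law (induced M \<pi>) (init M). \<exists>t. \<xi> t = w)"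

text \<open>In \<^typ>\<open>ennreal\<close>, \<open>inverse 0 = \<infinity>\<close>.\<close>

definition trans_info :: "('s, 'a) mdp \<Rightarrow> ('s \<Rightarrow> 'a pmf) \<Rightarrow> 's \<Rightarrow> ennreal" where
  "trans_info M \<pi> s =
     inverse (\<Sum>q\<in>succ_states M s. ennreal (pmf (induced M \<pi> s) q * (1 - pmf (induced M \<pi> s) q)))"

definition total_info :: "('s, 'a) mdp \<Rightarrow> ('s \<Rightarrow> 'a pmf) \<Rightarrow> 's set \<Rightarrow> (nat \<Rightarrow> 's) \<Rightarrow> ennreal" where
  "total_info M \<pi> W \<xi> = (\<Sum>t. if \<xi> t \<in> W then trans_info M \<pi> (\<xi> t) else 0)"

definition expected_info :: "('s, 'a) mdp \<Rightarrow> ('s \<Rightarrow> 'a pmf) \<Rightarrow> 's set \<Rightarrow> ennreal" where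
  "expected_info M \<pi> W = (\<integral>\<^sup>+\<xi>. total_info M \<pi> W \<xi> \<partial>path_law (induced M \<pi>) (init M))"


section \<open>Unbiased estimators and their mean squared error\<close>

text \<open>
  An estimator at \<open>w\<close> sees the whole path. The parameter \<open>\<theta>\<close> ranges over all probability
  vectors on the successors of \<open>w\<close>, and replaces the transition distribution at \<open>w\<close> only. As the
  Bochner integral of a non-integrable function is \<open>0\<close>, integrability is demanded explicitly.
\<close>

definition unbiased_estimator ::
  "('s, 'a) mdp \<Rightarrow> ('s \<Rightarrow> 'a pmf) \<Rightarrow> 's \<Rightarrow> ((nat \<Rightarrow> 's) \<Rightarrow> 's \<Rightarrow> real) \<Rightarrow> bool" where
  "unbiased_estimator M \<pi> w est \<longleftrightarrow>
     est \<in> measurable path_space (PiM (succ_states M w) (\<lambda>_. borel)) \<and>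
     (\<forall>\<theta>. set_pmf \<theta> \<subseteq> succ_states M w \<longrightarrow>
        (\<forall>q\<in>succ_states M w.
           integrable (path_law ((induced M \<pi>)(w := \<theta>)) (init M)) (\<lambda>\<xi>. est \<xi> q) \<and>
           (\<integral>\<xi>. est \<xi> q \<partial>path_law ((induced M \<pi>)(w := \<theta>)) (init M)) = pmf \<theta> q))"

text \<open>The mean squared error is not required to be finite.\<close>

definition mse ::
  "('s, 'a) mdp \<Rightarrow> ('s \<Rightarrow> 'a pmf) \<Rightarrow> 's \<Rightarrow> ((nat \<Rightarrow> 's) \<Rightarrow> 's \<Rightarrow> real) \<Rightarrow> ennreal" where
  "mse M \<pi> w est =
     (\<Sum>q\<in>succ_states M w.
        \<integral>\<^sup>+\<xi>. ennreal ((est \<xi> q - pmf (induced M \<pi> w) q)\<^sup>2) \<partial>path_law (induced M \<pi>) (init M))"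

end

theory Submission
  imports Defs
begin

text \<open>
  The data contain \<open>N\<^sub>w\<close> observed transitions out of \<open>w\<close>, where \<open>N\<^sub>w\<close> is the random number of visits to
  \<open>w\<close>. So the Fisher information of the path about the row \<open>p\<close> at \<open>w\<close> is the expectation of \<open>N\<^sub>w\<close> times
  that of a single transition, and the error of an unbiased estimator at \<open>w\<close> is at least
  \<open>V w / E[N\<^sub>w]\<close> with \<open>V w = (\<Sum>q. p q (1 - p q))\<close> (\<open>mse_lower_bound\<close>). The expected total information
  is \<open>(\<Sum>w\<in>W. E[N\<^sub>w] / V w)\<close> (\<open>expected_info_eq\<close>), so the inequality between the arithmetic and harmonic
  means gives \<open>|W|\<^sup>2 / E[\<iota>]\<close> as a lower bound for the total error whenever all observed states are
  reachable (\<open>total_mse_lower_bound\<close>). The factor with the reachability probabilities is at most \<open>1\<close>,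
  and it is \<open>0\<close> if some observed state is unreachable.

  The path is infinite, its number of observed transitions is random, and nothing but measurability
  and unbiasedness is known about the estimator. Therefore the information inequality is derived by
  comparing two parameters at a finite distance \<open>\<epsilon>\<close> (\<open>chapman_robbins\<close>) and letting \<open>\<epsilon>\<close> tend to \<open>0\<close>
  only at the very end (\<open>cramer_rao_coordinate\<close>). For this one needs that the perturbed chain has a
  density with respect to the original one on the space of infinite paths (\<open>path_law_perturbed\<close>), and
  that the variance of this density is at most \<open>\<epsilon>\<^sup>2\<close> times the Fisher information, up to a factor that
  tends to \<open>1\<close> (\<open>chi_square_LR\<close>). The density is a product over the visits to \<open>w\<close>, so its size is
  governed by exponential moments of \<open>N\<^sub>w\<close>. These are estimated by \<open>weighted_visits_le\<close>, which uses the
  Green function of the chain as a potential.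
\<close>

section \<open>Integrating functions of finitely many steps\<close>

text \<open>
  On a finite state space, a function of the first \<open>n + 1\<close> states is a finite linear combination of
  indicators of cylinders, whose probabilities are known. This is how
  integrals over paths are computed.
\<close>

definition depends_upto :: "nat \<Rightarrow> ((nat \<Rightarrow> 's) \<Rightarrow> 'b) \<Rightarrow> bool" where
  "depends_upto n f \<longleftrightarrow> (\<forall>\<xi> \<xi>'. (\<forall>i\<le>n. \<xi> i = \<xi>' i) \<longrightarrow> f \<xi> = f \<xi>')"

definition cylinder :: "nat \<Rightarrow> (nat \<Rightarrow> 's) \<Rightarrow> (nat \<Rightarrow> 's) set" where
  "cylinder n x = {\<xi>. \<forall>i\<le>n. \<xi> i = x i}"

abbreviation prefixes :: "nat \<Rightarrow> (nat \<Rightarrow> 's) set" where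
  "prefixes n \<equiv> PiE {..n} (\<lambda>_. UNIV)"

lemma depends_uptoI:
  "(\<And>\<xi> \<xi>'. (\<And>i. i \<le> n \<Longrightarrow> \<xi> i = \<xi>' i) \<Longrightarrow> f \<xi> = f \<xi>') \<Longrightarrow> depends_upto n f"
  unfolding depends_upto_def by blast

lemma depends_uptoD: "depends_upto n f \<Longrightarrow> (\<And>i. i \<le> n \<Longrightarrow> \<xi> i = \<xi>' i) \<Longrightarrow> f \<xi> = f \<xi>'"
  unfolding depends_upto_def by blast

lemma measurable_coordinate [measurable]:
  "(\<lambda>\<xi>. \<xi> i) \<in> measurable path_space (count_space UNIV)"
  by (rule measurable_component_singleton) simp

lemma measurable_path_law [simp]: "measurable (path_law K s) N = measurable path_space N"
  by (rule measurable_cong_sets) simp_all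

lemma measurable_function_of_coordinate [simp]:
  "(\<lambda>\<xi>. h (\<xi> i)) \<in> borel_measurable path_space"
  by (rule measurable_compose[OF measurable_coordinate]) simp

lemma measurable_indicator_coordinate [measurable]:
  "(\<lambda>\<xi>. indicator A (\<xi> i) :: ennreal) \<in> borel_measurable path_space"
  by simp

lemma sets_coordinate_eq [simp, measurable]: "{\<xi>. \<xi> i = x} \<in> sets path_space"
  using measurable_sets[OF measurable_coordinate[of i], of "{x}"] by (simp add: space_PiM vimage_def)

lemma sets_cylinder [measurable]: "cylinder n x \<in> sets path_space"
proof -
  have "cylinder n x = (\<Inter>i\<in>{..n}. {\<xi>. \<xi> i = x i})" by (auto simp: cylinder_def)
  also have "\<dots> \<in> sets path_space" by (rule sets.finite_INT) simp_all
  finally show ?thesis .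
qed

lemma emeasure_path_law_UNIV [simp]: "emeasure (path_law K s) UNIV = 1"
  using prob_space.emeasure_space_1[OF prob_space_path_law, of K s] by simp

lemma cylinder_expansion:
  fixes f :: "(nat \<Rightarrow> 's::finite) \<Rightarrow> ennreal"
  assumes "depends_upto n f"
  shows "f \<xi> = (\<Sum>x\<in>prefixes n. f x * indicator (cylinder n x) \<xi>)"
proof -
  have fin: "finite (prefixes n :: (nat \<Rightarrow> 's) set)" by (intro finite_PiE) auto
  have eq: "\<xi> \<in> cylinder n x \<longleftrightarrow> x = restrict \<xi> {..n}" if "x \<in> prefixes n" for x
    using that by (auto simp: cylinder_def fun_eq_iff PiE_iff extensional_def restrict_def)
  have "(\<Sum>x\<in>prefixes n. f x * indicator (cylinder n x) \<xi>)
      = (\<Sum>x\<in>prefixes n. if x = restrict \<xi> {..n} then f x else 0)"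
    by (intro sum.cong) (auto simp: indicator_def eq)
  also have "\<dots> = f (restrict \<xi> {..n})"
    using fin by simp
  also have "\<dots> = f \<xi>"
    by (rule depends_uptoD[OF assms]) simp
  finally show ?thesis by simp
qed

lemma measurable_depends_upto:
  fixes f :: "(nat \<Rightarrow> 's::finite) \<Rightarrow> ennreal"
  assumes "depends_upto n f"
  shows "f \<in> borel_measurable path_space"
  by (subst cylinder_expansion[OF assms, abs_def]) measurable

lemma nn_integral_depends_upto:
  fixes f k :: "(nat \<Rightarrow> 's::finite) \<Rightarrow> ennreal" and K :: "'s \<Rightarrow> 's pmf"
  assumes "depends_upto n f" and [measurable]: "k \<in> borel_measurable path_space"
  shows "(\<integral>\<^sup>+\<xi>. f \<xi> * k \<xi> \<partial>path_law K s)
       = (\<Sum>x\<in>prefixes n. f x * (\<integral>\<^sup>+\<xi>. indicator (cylinder n x) \<xi> * k \<xi> \<partial>path_law K s))"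
proof -
  have "(\<integral>\<^sup>+\<xi>. f \<xi> * k \<xi> \<partial>path_law K s)
      = (\<integral>\<^sup>+\<xi>. (\<Sum>x\<in>prefixes n. f x * (indicator (cylinder n x) \<xi> * k \<xi>)) \<partial>path_law K s)"
    by (subst cylinder_expansion[OF assms(1)]) (simp add: sum_distrib_right mult.assoc)
  also have "\<dots> = (\<Sum>x\<in>prefixes n. \<integral>\<^sup>+\<xi>. f x * (indicator (cylinder n x) \<xi> * k \<xi>) \<partial>path_law K s)"
    by (rule nn_integral_sum) measurable
  also have "\<dots> = (\<Sum>x\<in>prefixes n. f x * (\<integral>\<^sup>+\<xi>. indicator (cylinder n x) \<xi> * k \<xi> \<partial>path_law K s))"
    by (intro sum.cong refl nn_integral_cmult) measurable
  finally show ?thesis .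
qed

lemma emeasure_cylinder_Suc:
  "emeasure (path_law K s) (cylinder (Suc n) (x(Suc n := y)))
     = emeasure (path_law K s) (cylinder n x) * ennreal (pmf (K (x n)) y)"
proof -
  have "(\<Prod>i<n. pmf (K ((x(Suc n := y)) i)) ((x(Suc n := y)) (Suc i))) = (\<Prod>i<n. pmf (K (x i)) (x (Suc i)))"
    by (intro prod.cong) auto
  then show ?thesis
    unfolding cylinder_def emeasure_path_law_cylinder
    by (simp add: ennreal_mult'[symmetric] prod_nonneg del: fun_upd_apply)
      (simp add: mult.commute)
qed

text \<open>
  The Markov property, in the only form in which it is needed: given the past, the next state can be
  integrated out. Both sides are split over the cylinders of the past, on which everything but the
  next state is constant.
\<close>

lemma nn_integral_step:
  fixes K :: "'s::finite \<Rightarrow> 's pmf" and f :: "(nat \<Rightarrow> 's) \<Rightarrow> ennreal"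
  assumes f: "depends_upto n f"
  shows "(\<integral>\<^sup>+\<xi>. f \<xi> * \<phi> (\<xi> n) (\<xi> (Suc n)) \<partial>path_law K s)
       = (\<integral>\<^sup>+\<xi>. f \<xi> * (\<integral>\<^sup>+y. \<phi> (\<xi> n) y \<partial>K (\<xi> n)) \<partial>path_law K s)"
proof -
  let ?P = "path_law K s"
  have c1: "depends_upto (Suc n) (\<lambda>\<xi>. \<phi> (\<xi> n) (\<xi> (Suc n)))"
    and c2: "depends_upto n (\<lambda>\<xi>. \<integral>\<^sup>+y. \<phi> (\<xi> n) y \<partial>K (\<xi> n))"
    by (auto intro!: depends_uptoI)
  note [measurable] = measurable_depends_upto[OF c1] measurable_depends_upto[OF c2]
  have "(\<integral>\<^sup>+\<xi>. indicator (cylinder n x) \<xi> * \<phi> (\<xi> n) (\<xi> (Suc n)) \<partial>?P)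
      = (\<integral>\<^sup>+\<xi>. indicator (cylinder n x) \<xi> * (\<integral>\<^sup>+y. \<phi> (\<xi> n) y \<partial>K (\<xi> n)) \<partial>?P)" for x
  proof -
    have "(\<integral>\<^sup>+\<xi>. indicator (cylinder n x) \<xi> * \<phi> (\<xi> n) (\<xi> (Suc n)) \<partial>?P)
        = (\<integral>\<^sup>+\<xi>. (\<Sum>y\<in>UNIV. \<phi> (x n) y * indicator (cylinder (Suc n) (x(Suc n := y))) \<xi>) \<partial>?P)"
    proof (intro nn_integral_cong)
      fix \<xi> :: "nat \<Rightarrow> 's"
      have "\<xi> \<in> cylinder (Suc n) (x(Suc n := y)) \<longleftrightarrow> \<xi> \<in> cylinder n x \<and> y = \<xi> (Suc n)" for y
        by (auto simp: cylinder_def le_Suc_eq)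
      then have "(\<Sum>y\<in>UNIV. \<phi> (x n) y * indicator (cylinder (Suc n) (x(Suc n := y))) \<xi>)
          = (\<Sum>y\<in>UNIV. if y = \<xi> (Suc n) then indicator (cylinder n x) \<xi> * \<phi> (x n) y else 0)"
        by (intro sum.cong) (auto simp: indicator_def)
      then show "indicator (cylinder n x) \<xi> * \<phi> (\<xi> n) (\<xi> (Suc n))
          = (\<Sum>y\<in>UNIV. \<phi> (x n) y * indicator (cylinder (Suc n) (x(Suc n := y))) \<xi>)"
        by (auto simp: cylinder_def indicator_def)
    qed
    also have "\<dots> = (\<Sum>y\<in>UNIV. \<phi> (x n) y * emeasure ?P (cylinder (Suc n) (x(Suc n := y))))"
      by (subst nn_integral_sum) (auto simp: nn_integral_cmult_indicator)
    also have "\<dots> = (\<Sum>y\<in>UNIV. \<phi> (x n) y * pmf (K (x n)) y) * emeasure ?P (cylinder n x)"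
      unfolding emeasure_cylinder_Suc by (simp add: sum_distrib_right mult.assoc mult.commute[of "emeasure _ _"])
    also have "(\<Sum>y\<in>UNIV. \<phi> (x n) y * pmf (K (x n)) y) = (\<integral>\<^sup>+y. \<phi> (x n) y \<partial>K (x n))"
      by (subst nn_integral_measure_pmf_support[of UNIV]) auto
    also have "\<dots> * emeasure ?P (cylinder n x)
        = (\<integral>\<^sup>+\<xi>. (\<integral>\<^sup>+y. \<phi> (x n) y \<partial>K (x n)) * indicator (cylinder n x) \<xi> \<partial>?P)"
      by (rule nn_integral_cmult_indicator[symmetric]) simp
    also have "\<dots> = (\<integral>\<^sup>+\<xi>. indicator (cylinder n x) \<xi> * (\<integral>\<^sup>+y. \<phi> (\<xi> n) y \<partial>K (\<xi> n)) \<partial>?P)"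
      by (intro nn_integral_cong) (auto simp: indicator_def cylinder_def)
    finally show ?thesis .
  qed
  then show ?thesis
    by (simp add: nn_integral_depends_upto[OF f])
qed

lemma nn_integral_start:
  fixes K :: "'s::finite \<Rightarrow> 's pmf" and h :: "'s \<Rightarrow> ennreal"
  shows "(\<integral>\<^sup>+\<xi>. h (\<xi> 0) \<partial>path_law K s) = h s"
proof -
  interpret prob_space "path_law K s" by (rule prob_space_path_law)
  have "emeasure (path_law K s) (cylinder 0 (\<lambda>_. s)) = 1"
    unfolding cylinder_def by (subst emeasure_path_law_cylinder) simp
  then have "AE \<xi> in path_law K s. \<xi> \<in> cylinder 0 (\<lambda>_. s)"
    by (intro AE_prob_1) (simp add: measure_def)
  then have "(\<integral>\<^sup>+\<xi>. h (\<xi> 0) \<partial>path_law K s) = (\<integral>\<^sup>+\<xi>. h s \<partial>path_law K s)"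
    by (intro nn_integral_cong_AE) (auto simp: cylinder_def)
  then show ?thesis by simp
qed


section \<open>The expected number of visits\<close>

primrec visit_prob :: "('s \<Rightarrow> 's pmf) \<Rightarrow> 's \<Rightarrow> nat \<Rightarrow> 's \<Rightarrow> ennreal" where
  "visit_prob K w 0 x = indicator {w} x"
| "visit_prob K w (Suc n) x = (\<integral>\<^sup>+y. visit_prob K w n y \<partial>K x)"

text \<open>
  The Green function, the expected number of visits to \<open>w\<close> of the chain started in \<open>x\<close>. It is set
  up algebraically because only its first-step equation and its value at the initial state matter;
  \<open>nn_integral_visits\<close> below makes the link to paths.
\<close>

definition green :: "('s \<Rightarrow> 's pmf) \<Rightarrow> 's \<Rightarrow> 's \<Rightarrow> ennreal" where
  "green K w x = (\<Sum>n. visit_prob K w n x)"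

lemma green_first_step: "green K w x = indicator {w} x + (\<integral>\<^sup>+y. green K w y \<partial>K x)"
proof -
  have "green K w x = visit_prob K w 0 x + (\<Sum>n. visit_prob K w (Suc n) x)"
    unfolding green_def
    using suminf_offset[of "\<lambda>n. visit_prob K w n x" "Suc 0"] by simp
  also have "(\<Sum>n. visit_prob K w (Suc n) x) = (\<integral>\<^sup>+y. green K w y \<partial>K x)"
    by (simp add: green_def nn_integral_suminf)
  finally show ?thesis by simp
qed

lemma nn_integral_visit_prob:
  fixes K :: "'s::finite \<Rightarrow> 's pmf"
  shows "(\<integral>\<^sup>+\<xi>. visit_prob K w k (\<xi> t) \<partial>path_law K s) = visit_prob K w (k + t) s"
proof (induction t arbitrary: k)
  case 0
  then show ?case by (simp add: nn_integral_start)
next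
  case (Suc t)
  have "(\<integral>\<^sup>+\<xi>. visit_prob K w k (\<xi> (Suc t)) \<partial>path_law K s) = (\<integral>\<^sup>+\<xi>. visit_prob K w (Suc k) (\<xi> t) \<partial>path_law K s)"
    using nn_integral_step[where n = t and f = "\<lambda>_. 1" and \<phi> = "\<lambda>_. visit_prob K w k" and K = K and s = s]
    by (simp add: depends_upto_def)
  then show ?case using Suc.IH[of "Suc k"] by simp
qed

lemma emeasure_visit:
  fixes K :: "'s::finite \<Rightarrow> 's pmf"
  shows "emeasure (path_law K s) {\<xi>. \<xi> t = w} = visit_prob K w t s"
proof -
  have "emeasure (path_law K s) {\<xi>. \<xi> t = w} = (\<integral>\<^sup>+\<xi>. indicator {\<xi>. \<xi> t = w} \<xi> \<partial>path_law K s)"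
    by simp
  also have "\<dots> = (\<integral>\<^sup>+\<xi>. visit_prob K w 0 (\<xi> t) \<partial>path_law K s)"
    by (intro nn_integral_cong) (simp add: indicator_def)
  finally show ?thesis using nn_integral_visit_prob[where k = 0 and K = K and w = w and s = s] by simp
qed

lemma measurable_visits [measurable, simp]:
  "(\<lambda>\<xi>. \<Sum>t. indicator {w} (\<xi> t) :: ennreal) \<in> borel_measurable path_space"
  by (intro borel_measurable_suminf_order) simp

lemma nn_integral_visits:
  fixes K :: "'s::finite \<Rightarrow> 's pmf"
  shows "(\<integral>\<^sup>+\<xi>. (\<Sum>t. indicator {w} (\<xi> t)) \<partial>path_law K s) = green K w s"
proof -
  have "(\<integral>\<^sup>+\<xi>. (\<Sum>t. indicator {w} (\<xi> t)) \<partial>path_law K s) = (\<Sum>t. \<integral>\<^sup>+\<xi>. indicator {w} (\<xi> t) \<partial>path_law K s)"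
    by (intro nn_integral_suminf) simp_all
  also have "\<dots> = green K w s"
    using nn_integral_visit_prob[where k = 0 and K = K and w = w and s = s] by (simp add: green_def)
  finally show ?thesis .
qed

lemma green_ge_visit_prob: "visit_prob K w t s \<le> green K w s"
  unfolding green_def using sum_le_suminf[of "\<lambda>t. visit_prob K w t s" "{t}"] by (simp add: summableI)

text \<open>
  The visits from time \<open>t\<close> on are at least those made after being in \<open>w\<close> at time \<open>t\<close>. This is what
  makes the Green function finite at \<open>w\<close> itself once \<open>w\<close> is reachable and the expected number of
  visits from the initial state is finite.
\<close>

lemma visit_prob_mult_green_le:
  fixes K :: "'s::finite \<Rightarrow> 's pmf"
  shows "visit_prob K w t s * green K w w \<le> green K w s"
proof -
  have "visit_prob K w t s * green K w w = (\<integral>\<^sup>+\<xi>. indicator {w} (\<xi> t) * green K w w \<partial>path_law K s)"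
    using nn_integral_visit_prob[where k = 0 and K = K and w = w and s = s]
    by (subst nn_integral_multc) simp_all
  also have "\<dots> \<le> (\<integral>\<^sup>+\<xi>. (\<Sum>k. visit_prob K w k (\<xi> t)) \<partial>path_law K s)"
    by (intro nn_integral_mono) (auto simp: indicator_def green_def)
  also have "\<dots> = (\<Sum>k. visit_prob K w (k + t) s)"
    by (subst nn_integral_suminf) (simp_all add: nn_integral_visit_prob)
  also have "\<dots> \<le> green K w s"
    unfolding green_def
    by (subst (2) suminf_offset[of _ t]) (auto intro: summableI)
  finally show ?thesis .
qed

lemma ex_visit_prob_pos:
  fixes K :: "'s::finite \<Rightarrow> 's pmf"
  assumes "\<P>(\<xi> in path_law K s. \<exists>t. \<xi> t = w) \<noteq> 0"
  obtains t where "visit_prob K w t s \<noteq> 0"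
proof -
  have "\<exists>t. visit_prob K w t s \<noteq> 0"
  proof (rule ccontr)
    assume "\<nexists>t. visit_prob K w t s \<noteq> 0"
    then have "{\<xi>. \<xi> t = w} \<in> null_sets (path_law K s)" for t
      by (intro null_setsI) (auto simp: emeasure_visit)
    then have "(\<Union>t. {\<xi>. \<xi> t = w}) \<in> null_sets (path_law K s)"
      by (intro null_sets_UN) auto
    moreover have "(\<Union>t. {\<xi>. \<xi> t = w}) = {\<xi> \<in> space (path_law K s). \<exists>t. \<xi> t = w}" by auto
    ultimately show False
      using assms by (simp add: measure_def null_setsD1)
  qed
  then show thesis using that by blast
qed

text \<open>
  Multiplying in a factor \<open>b\<close> at every visit of \<open>w\<close> turns the Green function into a supermartingale
  potential as long as \<open>b\<close> times its average after \<open>w\<close> stays below its value at \<open>w\<close>: away from \<open>w\<close>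
  the weighted Green function is preserved on average, and each visit to \<open>w\<close> costs at least \<open>\<kappa>\<close> times
  the current weight. Summing the costs bounds the expected weighted number of visits. In this way
  geometric moments of the number of visits are controlled, with the sharp constant, without
  computing its distribution.
\<close>

lemma weighted_visits_le:
  fixes K :: "'s::finite \<Rightarrow> 's pmf" and b \<kappa> :: ennreal
  assumes "b * (\<integral>\<^sup>+y. green K w y \<partial>K w) + \<kappa> \<le> green K w w"
  shows "\<kappa> * (\<Sum>t<n. \<integral>\<^sup>+\<xi>. (\<Prod>i<t. if \<xi> i = w then b else 1) * indicator {w} (\<xi> t) \<partial>path_law K s)
       \<le> green K w s"
proof -
  define B where "B t \<xi> = (\<Prod>i<t. if \<xi> i = w then b else 1)" for t :: nat and \<xi>
  have B: "depends_upto t (B t)" for t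
    unfolding B_def by (intro depends_uptoI prod.cong refl) simp
  note [measurable] = measurable_depends_upto[OF B]
  have coord [measurable]: "(\<lambda>\<xi>. h (\<xi> t)) \<in> borel_measurable path_space" for t and h :: "'s \<Rightarrow> ennreal"
    by simp
  \<comment> \<open>the loss of potential in one step pays for a visit\<close>
  have step: "(\<integral>\<^sup>+\<xi>. B (Suc t) \<xi> * green K w (\<xi> (Suc t)) \<partial>path_law K s)
      + \<kappa> * (\<integral>\<^sup>+\<xi>. B t \<xi> * indicator {w} (\<xi> t) \<partial>path_law K s)
      \<le> (\<integral>\<^sup>+\<xi>. B t \<xi> * green K w (\<xi> t) \<partial>path_law K s)" for t
  proof -
    have "(\<integral>\<^sup>+\<xi>. B (Suc t) \<xi> * green K w (\<xi> (Suc t)) \<partial>path_law K s)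
        = (\<integral>\<^sup>+\<xi>. B t \<xi> * ((if \<xi> t = w then b else 1) * green K w (\<xi> (Suc t))) \<partial>path_law K s)"
      by (intro nn_integral_cong) (simp add: B_def ac_simps)
    also have "\<dots> = (\<integral>\<^sup>+\<xi>. B t \<xi> * (\<integral>\<^sup>+y. (if \<xi> t = w then b else 1) * green K w y \<partial>K (\<xi> t)) \<partial>path_law K s)"
      using nn_integral_step[OF B, where \<phi> = "\<lambda>x y. (if x = w then b else 1) * green K w y"] by simp
    finally have *: "(\<integral>\<^sup>+\<xi>. B (Suc t) \<xi> * green K w (\<xi> (Suc t)) \<partial>path_law K s)
      + \<kappa> * (\<integral>\<^sup>+\<xi>. B t \<xi> * indicator {w} (\<xi> t) \<partial>path_law K s)
      = (\<integral>\<^sup>+\<xi>. B t \<xi> * (\<integral>\<^sup>+y. (if \<xi> t = w then b else 1) * green K w y \<partial>K (\<xi> t)) \<partial>path_law K s)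
      + (\<integral>\<^sup>+\<xi>. \<kappa> * (B t \<xi> * indicator {w} (\<xi> t)) \<partial>path_law K s)"
      by (subst nn_integral_cmult) auto
    have **: "(\<integral>\<^sup>+\<xi>. B t \<xi> * (\<integral>\<^sup>+y. (if \<xi> t = w then b else 1) * green K w y \<partial>K (\<xi> t)) \<partial>path_law K s)
      + (\<integral>\<^sup>+\<xi>. \<kappa> * (B t \<xi> * indicator {w} (\<xi> t)) \<partial>path_law K s)
      = (\<integral>\<^sup>+\<xi>. B t \<xi> * (\<integral>\<^sup>+y. (if \<xi> t = w then b else 1) * green K w y \<partial>K (\<xi> t))
          + \<kappa> * (B t \<xi> * indicator {w} (\<xi> t)) \<partial>path_law K s)"
      using coord[of "\<lambda>x. \<integral>\<^sup>+y. (if x = w then b else 1) * green K w y \<partial>K x" t]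
      by (intro nn_integral_add[symmetric]) auto
    show ?thesis
      unfolding * **
    proof (intro nn_integral_mono)
      fix \<xi> :: "nat \<Rightarrow> 's"
      have "(\<integral>\<^sup>+y. (if \<xi> t = w then b else 1) * green K w y \<partial>K (\<xi> t)) + \<kappa> * indicator {w} (\<xi> t)
          \<le> green K w (\<xi> t)"
        using assms green_first_step[of K w "\<xi> t"] by (auto simp: nn_integral_cmult indicator_def)
      from mult_left_mono[OF this, of "B t \<xi>"]
      show "B t \<xi> * (\<integral>\<^sup>+y. (if \<xi> t = w then b else 1) * green K w y \<partial>K (\<xi> t))
          + \<kappa> * (B t \<xi> * indicator {w} (\<xi> t)) \<le> B t \<xi> * green K w (\<xi> t)"
        by (simp add: distrib_left ac_simps)
    qed
  qed
  have "(\<integral>\<^sup>+\<xi>. B n \<xi> * green K w (\<xi> n) \<partial>path_law K s)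
      + \<kappa> * (\<Sum>t<n. \<integral>\<^sup>+\<xi>. B t \<xi> * indicator {w} (\<xi> t) \<partial>path_law K s) \<le> green K w s"
  proof (induction n)
    case 0
    then show ?case by (simp add: B_def nn_integral_start)
  next
    case (Suc n)
    let ?S = "\<Sum>t<n. \<integral>\<^sup>+\<xi>. B t \<xi> * indicator {w} (\<xi> t) \<partial>path_law K s"
    have "(\<integral>\<^sup>+\<xi>. B (Suc n) \<xi> * green K w (\<xi> (Suc n)) \<partial>path_law K s)
        + \<kappa> * (\<Sum>t<Suc n. \<integral>\<^sup>+\<xi>. B t \<xi> * indicator {w} (\<xi> t) \<partial>path_law K s)
      = ((\<integral>\<^sup>+\<xi>. B (Suc n) \<xi> * green K w (\<xi> (Suc n)) \<partial>path_law K s)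
        + \<kappa> * (\<integral>\<^sup>+\<xi>. B n \<xi> * indicator {w} (\<xi> n) \<partial>path_law K s)) + \<kappa> * ?S"
      by (simp add: distrib_left add_ac)
    also have "\<dots> \<le> (\<integral>\<^sup>+\<xi>. B n \<xi> * green K w (\<xi> n) \<partial>path_law K s) + \<kappa> * ?S"
      by (rule add_right_mono[OF step])
    also have "\<dots> \<le> green K w s" by (rule Suc)
    finally show ?case .
  qed
  then have "\<kappa> * (\<Sum>t<n. \<integral>\<^sup>+\<xi>. B t \<xi> * indicator {w} (\<xi> t) \<partial>path_law K s) \<le> green K w s"
    by (rule order_trans[rotated]) simp
  then show ?thesis by (simp add: B_def)
qed


section \<open>Change of measure when one row of the kernel is perturbed\<close>

text \<open>
  The transition distribution at \<open>w\<close> is replaced by \<open>\<theta>\<close>, which has density \<open>r\<close> with respect to it.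
  The number \<open>\<kappa>\<close> is the gap required by \<open>weighted_visits_le\<close> for the factor \<open>c\<^sup>2\<close>; the square is
  there because second moments of the likelihood ratio have to be bounded. When \<open>c\<close> tends to \<open>1\<close>, the
  largest possible \<open>\<kappa>\<close> tends to \<open>1\<close>.
\<close>

locale row_perturbation =
  fixes K :: "'s::finite \<Rightarrow> 's pmf" and s w :: 's and \<theta> :: "'s pmf" and r :: "'s \<Rightarrow> real"
    and c \<kappa> :: real
  assumes pmf_perturbed: "pmf \<theta> y = pmf (K w) y * r y"
    and ratio_nonneg: "0 \<le> r y" and ratio_le: "r y \<le> c" and one_le_c: "1 \<le> c"
    and \<kappa>_pos: "0 < \<kappa>"
    and green_gap: "ennreal (c\<^sup>2) * (\<integral>\<^sup>+y. green K w y \<partial>K w) + ennreal \<kappa> \<le> green K w w"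
    and green_finite: "green K w s \<noteq> \<infinity>"
begin

abbreviation "P \<equiv> path_law K s"

text \<open>
  The chi-square divergence of \<open>\<theta>\<close> from the original row, that is, the variance of \<open>r\<close> under it.
\<close>

definition chi2 :: real where "chi2 = (\<Sum>y\<in>UNIV. pmf (K w) y * (r y)\<^sup>2) - 1"

text \<open>
  The likelihood ratio of the first \<open>n\<close> steps. It changes only at visits to \<open>w\<close>, hence it is eventually
  constant on almost every path when the expected number of visits is finite.
\<close>

definition lr :: "nat \<Rightarrow> (nat \<Rightarrow> 's) \<Rightarrow> real" where
  "lr n \<xi> = (\<Prod>i<n. if \<xi> i = w then r (\<xi> (Suc i)) else 1)"

definition weight :: "nat \<Rightarrow> (nat \<Rightarrow> 's) \<Rightarrow> ennreal" where
  "weight n \<xi> = (\<Prod>i<n. if \<xi> i = w then ennreal (c\<^sup>2) else 1)"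

definition LR :: "(nat \<Rightarrow> 's) \<Rightarrow> real" where
  "LR \<xi> = lim (\<lambda>n. lr n \<xi>)"

lemma lr_nonneg: "0 \<le> lr n \<xi>"
  unfolding lr_def by (intro prod_nonneg) (auto simp: ratio_nonneg)

lemma depends_upto_lr: "depends_upto n (lr n)"
  unfolding lr_def by (intro depends_uptoI prod.cong refl) simp

lemma depends_upto_comp: "depends_upto n f \<Longrightarrow> depends_upto n (\<lambda>\<xi>. g (f \<xi>))"
  unfolding depends_upto_def by metis

lemma measurable_lr [measurable]: "lr n \<in> borel_measurable path_space"
proof -
  have "(\<lambda>\<xi>. enn2real (ennreal (lr n \<xi>))) \<in> borel_measurable path_space"
    using measurable_depends_upto[OF depends_upto_comp[OF depends_upto_lr, where g = ennreal]]
    by measurable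
  then show ?thesis by (simp add: lr_nonneg)
qed

lemma depends_upto_weight: "depends_upto n (weight n)"
  unfolding weight_def by (intro depends_uptoI prod.cong refl) simp

lemma measurable_weight [measurable]: "weight n \<in> borel_measurable path_space"
  by (rule measurable_depends_upto[OF depends_upto_weight])

lemma one_le_c2: "1 \<le> c\<^sup>2"
  using one_le_c by simp

lemma lr_le_weight: "ennreal (lr n \<xi>) \<le> weight n \<xi>"
proof -
  have "r y \<le> c\<^sup>2" for y
    using ratio_le[of y] self_le_power[OF one_le_c, of 2] by simp
  then show ?thesis
    unfolding lr_def weight_def
    by (subst prod_ennreal[symmetric]) (auto simp: ratio_nonneg intro!: prod_mono_ennreal ennreal_leI)
qed

lemma lr_square_le_weight: "ennreal ((lr n \<xi>)\<^sup>2) \<le> weight n \<xi>"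
proof -
  have "(r y)\<^sup>2 \<le> c\<^sup>2" for y
    using ratio_le[of y] ratio_nonneg[of y] by (simp add: power_mono)
  then show ?thesis
    unfolding lr_def weight_def prod_power_distrib
    by (subst prod_ennreal[symmetric]) (auto intro!: prod_mono_ennreal ennreal_leI)
qed

lemma nn_integral_ratio: "(\<integral>\<^sup>+y. ennreal (r y) \<partial>K w) = 1"
proof -
  have "(\<integral>\<^sup>+y. ennreal (r y) \<partial>K w) = (\<Sum>y\<in>UNIV. ennreal (pmf \<theta> y))"
    by (subst nn_integral_measure_pmf_support[of UNIV])
      (auto simp: pmf_perturbed ennreal_mult' ratio_nonneg mult.commute)
  also have "\<dots> = 1"
    by (simp add: sum_pmf_eq_1)
  finally show ?thesis .
qed

lemma chi2_nonneg: "0 \<le> chi2"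
proof -
  have s1: "(\<Sum>y\<in>UNIV. pmf (K w) y) = 1" and s2: "(\<Sum>y\<in>UNIV. pmf (K w) y * r y) = 1"
    by (simp_all add: sum_pmf_eq_1 pmf_perturbed[symmetric])
  have "0 \<le> (\<Sum>y\<in>UNIV. pmf (K w) y * (r y - 1)\<^sup>2)"
    by (intro sum_nonneg) auto
  also have "\<dots> = (\<Sum>y\<in>UNIV. pmf (K w) y * (r y)\<^sup>2 - 2 * (pmf (K w) y * r y) + pmf (K w) y)"
    by (intro sum.cong) (auto simp: power2_eq_square algebra_simps)
  also have "\<dots> = chi2"
    by (simp add: sum.distrib sum_subtractf sum_distrib_left[symmetric] s1 s2 chi2_def)
  finally show ?thesis .
qed

lemma nn_integral_ratio_square: "(\<integral>\<^sup>+y. ennreal ((r y)\<^sup>2) \<partial>K w) = 1 + ennreal chi2"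
proof -
  have "(\<integral>\<^sup>+y. ennreal ((r y)\<^sup>2) \<partial>K w) = ennreal (\<Sum>y\<in>UNIV. pmf (K w) y * (r y)\<^sup>2)"
    by (subst nn_integral_measure_pmf_support[of UNIV])
      (auto simp: ennreal_mult'[symmetric] mult.commute)
  also have "\<dots> = ennreal (1 + chi2)" by (simp add: chi2_def)
  also have "\<dots> = 1 + ennreal chi2" using chi2_nonneg by (subst ennreal_plus) auto
  finally show ?thesis .
qed

text \<open>
  The likelihood ratios form a martingale: a step from \<open>w\<close> multiplies by \<open>r\<close>, which has mean \<open>1\<close>.
\<close>

lemma nn_integral_lr_extend:
  assumes "depends_upto n f" "n \<le> m"
  shows "(\<integral>\<^sup>+\<xi>. f \<xi> * ennreal (lr m \<xi>) \<partial>P) = (\<integral>\<^sup>+\<xi>. f \<xi> * ennreal (lr n \<xi>) \<partial>P)"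
  using \<open>n \<le> m\<close>
proof (induction m rule: dec_induct)
  case (step m)
  have dep: "depends_upto m (\<lambda>\<xi>. f \<xi> * ennreal (lr m \<xi>))"
  proof (rule depends_uptoI)
    fix \<xi> \<xi>' :: "nat \<Rightarrow> 's" assume "\<And>i. i \<le> m \<Longrightarrow> \<xi> i = \<xi>' i"
    then show "f \<xi> * ennreal (lr m \<xi>) = f \<xi>' * ennreal (lr m \<xi>')"
      using depends_uptoD[OF assms(1), of \<xi> \<xi>'] depends_uptoD[OF depends_upto_lr, of m \<xi> \<xi>'] step.hyps(1)
      by simp
  qed
  have "(\<integral>\<^sup>+\<xi>. f \<xi> * ennreal (lr (Suc m) \<xi>) \<partial>P)
      = (\<integral>\<^sup>+\<xi>. f \<xi> * ennreal (lr m \<xi>) * ennreal (if \<xi> m = w then r (\<xi> (Suc m)) else 1) \<partial>P)"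
    by (intro nn_integral_cong) (simp add: lr_def ennreal_mult'' ratio_nonneg mult.assoc)
  also have "\<dots> = (\<integral>\<^sup>+\<xi>. f \<xi> * ennreal (lr m \<xi>) * (\<integral>\<^sup>+y. ennreal (if \<xi> m = w then r y else 1) \<partial>K (\<xi> m)) \<partial>P)"
    using nn_integral_step[OF dep, where \<phi> = "\<lambda>x y. ennreal (if x = w then r y else 1)"] .
  also have "\<dots> = (\<integral>\<^sup>+\<xi>. f \<xi> * ennreal (lr m \<xi>) \<partial>P)"
  proof -
    have "(\<integral>\<^sup>+y. ennreal (if x = w then r y else 1) \<partial>K x) = 1" for x
      by (cases "x = w") (auto simp: nn_integral_ratio)
    then show ?thesis by simp
  qed
  finally show ?case using step.IH by simp
qed simp

lemma nn_integral_lr: "(\<integral>\<^sup>+\<xi>. ennreal (lr n \<xi>) \<partial>P) = 1"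
  using nn_integral_lr_extend[of 0 "\<lambda>_. 1" n]
  by (simp add: depends_upto_def lr_def)

text \<open>
  By orthogonality of martingale increments, every visit to \<open>w\<close> adds \<open>chi2\<close> times the current squared
  likelihood ratio to the second moment.
\<close>

lemma nn_integral_lr_square:
  "(\<integral>\<^sup>+\<xi>. ennreal ((lr n \<xi>)\<^sup>2) \<partial>P)
     = 1 + ennreal chi2 * (\<Sum>t<n. \<integral>\<^sup>+\<xi>. ennreal ((lr t \<xi>)\<^sup>2) * indicator {w} (\<xi> t) \<partial>P)"
proof (induction n)
  case 0
  then show ?case by (simp add: lr_def)
next
  case (Suc n)
  let ?f = "\<lambda>\<xi>. ennreal ((lr n \<xi>)\<^sup>2)"
  have dep: "depends_upto n ?f"
    by (rule depends_upto_comp[OF depends_upto_lr])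
  have "(\<integral>\<^sup>+\<xi>. ennreal ((lr (Suc n) \<xi>)\<^sup>2) \<partial>P)
      = (\<integral>\<^sup>+\<xi>. ?f \<xi> * ennreal (if \<xi> n = w then (r (\<xi> (Suc n)))\<^sup>2 else 1) \<partial>P)"
    by (intro nn_integral_cong) (simp add: lr_def ennreal_mult'' power_mult_distrib)
  also have "\<dots> = (\<integral>\<^sup>+\<xi>. ?f \<xi> * (\<integral>\<^sup>+y. ennreal (if \<xi> n = w then (r y)\<^sup>2 else 1) \<partial>K (\<xi> n)) \<partial>P)"
    using nn_integral_step[OF dep, where \<phi> = "\<lambda>x y. ennreal (if x = w then (r y)\<^sup>2 else 1)"] .
  also have "\<dots> = (\<integral>\<^sup>+\<xi>. ?f \<xi> + ennreal chi2 * (?f \<xi> * indicator {w} (\<xi> n)) \<partial>P)"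
  proof -
    have "(\<integral>\<^sup>+y. ennreal (if x = w then (r y)\<^sup>2 else 1) \<partial>K x) = 1 + ennreal chi2 * indicator {w} x" for x
      by (cases "x = w") (auto simp: nn_integral_ratio_square)
    then show ?thesis by (simp add: distrib_left ac_simps)
  qed
  also have "\<dots> = (\<integral>\<^sup>+\<xi>. ?f \<xi> \<partial>P) + ennreal chi2 * (\<integral>\<^sup>+\<xi>. ?f \<xi> * indicator {w} (\<xi> n) \<partial>P)"
    by (subst nn_integral_add) (simp_all add: nn_integral_cmult)
  finally show ?case
    unfolding Suc.IH by (simp add: distrib_left ac_simps)
qed

text \<open>
  The variance of the likelihood ratio is at most \<open>chi2\<close> times the expected number of visits, up to
  the factor \<open>1 / \<kappa>\<close>. This is the finite form of the fact that the Fisher information of a path is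
  that of one transition times the expected number of observed transitions.
\<close>

lemma chi_square_lr: "ennreal \<kappa> * (\<integral>\<^sup>+\<xi>. ennreal ((lr n \<xi> - 1)\<^sup>2) \<partial>P) \<le> ennreal chi2 * green K w s"
proof -
  let ?S = "\<Sum>t<n. \<integral>\<^sup>+\<xi>. ennreal ((lr t \<xi>)\<^sup>2) * indicator {w} (\<xi> t) \<partial>P"
  \<comment> \<open>the cross term of \<open>(lr n - 1)\<^sup>2\<close> is moved to the other side, as \<^typ>\<open>ennreal\<close> has no negative values\<close>
  have "(\<integral>\<^sup>+\<xi>. ennreal ((lr n \<xi> - 1)\<^sup>2) \<partial>P) + 2 = (\<integral>\<^sup>+\<xi>. ennreal ((lr n \<xi> - 1)\<^sup>2) + 2 * ennreal (lr n \<xi>) \<partial>P)"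
    by (subst nn_integral_add) (simp_all add: nn_integral_cmult nn_integral_lr)
  also have "\<dots> = (\<integral>\<^sup>+\<xi>. ennreal ((lr n \<xi>)\<^sup>2) + 1 \<partial>P)"
  proof (intro nn_integral_cong)
    fix \<xi>
    have "ennreal ((lr n \<xi> - 1)\<^sup>2) + 2 * ennreal (lr n \<xi>) = ennreal ((lr n \<xi> - 1)\<^sup>2 + 2 * lr n \<xi>)"
      using lr_nonneg[of n \<xi>] by (simp add: ennreal_mult')
    also have "(lr n \<xi> - 1)\<^sup>2 + 2 * lr n \<xi> = (lr n \<xi>)\<^sup>2 + 1"
      by (simp add: power2_eq_square algebra_simps)
    finally show "ennreal ((lr n \<xi> - 1)\<^sup>2) + 2 * ennreal (lr n \<xi>) = ennreal ((lr n \<xi>)\<^sup>2) + 1"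
      by simp
  qed
  also have "\<dots> = (1 + ennreal chi2 * ?S) + 1"
    by (subst nn_integral_add) (simp_all add: nn_integral_lr_square)
  also have "\<dots> = ennreal chi2 * ?S + 2"
    by (simp add: ac_simps)
  finally have eq: "(\<integral>\<^sup>+\<xi>. ennreal ((lr n \<xi> - 1)\<^sup>2) \<partial>P) = ennreal chi2 * ?S"
    by (simp add: add.commute[of _ 2] ennreal_add_left_cancel)
  have "ennreal \<kappa> * ?S \<le> ennreal \<kappa> * (\<Sum>t<n. \<integral>\<^sup>+\<xi>. weight t \<xi> * indicator {w} (\<xi> t) \<partial>P)"
    by (intro mult_left_mono sum_mono nn_integral_mono mult_right_mono lr_square_le_weight) auto
  also have "\<dots> \<le> green K w s"
    unfolding weight_def by (rule weighted_visits_le[OF green_gap])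
  finally have "ennreal chi2 * (ennreal \<kappa> * ?S) \<le> ennreal chi2 * green K w s"
    by (intro mult_left_mono) auto
  then show ?thesis unfolding eq by (simp add: ac_simps)
qed

lemma AE_lr_tendsto: "AE \<xi> in P. (\<lambda>n. lr n \<xi>) \<longlonglongrightarrow> LR \<xi>"
proof -
  have "AE \<xi> in P. (\<Sum>t. indicator {w} (\<xi> t) :: ennreal) \<noteq> \<infinity>"
    using green_finite by (intro nn_integral_noteq_infinite) (simp_all add: nn_integral_visits)
  then show ?thesis
  proof eventually_elim
    case (elim \<xi>)
    have "(\<Sum>t. ennreal (indicator {w} (\<xi> t))) \<noteq> \<top>"
      using elim by (simp add: ennreal_indicator)
    then have "summable (\<lambda>t. indicator {w} (\<xi> t) :: real)"
      by (intro summable_suminf_not_top) auto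
    then have "(\<lambda>t. indicator {w} (\<xi> t) :: real) \<longlonglongrightarrow> 0"
      by (rule summable_LIMSEQ_zero)
    then have "eventually (\<lambda>t. (indicator {w} (\<xi> t) :: real) < 1) sequentially"
      by (rule order_tendstoD) simp
    then obtain T where T: "\<And>t. t \<ge> T \<Longrightarrow> \<xi> t \<noteq> w"
      by (auto simp: eventually_sequentially indicator_def split: if_splits)
    have "lr n \<xi> = lr T \<xi>" if "n \<ge> T" for n
      using that by (induction n rule: dec_induct) (simp_all add: lr_def T)
    then have "(\<lambda>n. lr n \<xi>) \<longlonglongrightarrow> lr T \<xi>"
      by (intro tendsto_eventually eventually_sequentiallyI[of T])
    then show ?case
      unfolding LR_def by (simp add: limI)
  qed
qed

lemma measurable_LR [measurable]: "LR \<in> borel_measurable path_space"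
  unfolding LR_def[abs_def] by (rule borel_measurable_lim_metric) measurable

lemma AE_LR_nonneg: "AE \<xi> in P. 0 \<le> LR \<xi>"
  using AE_lr_tendsto by eventually_elim (rule LIMSEQ_le_const, auto simp: lr_nonneg)

lemma measurable_weighted_visits [measurable, simp]:
  "(\<lambda>\<xi>. \<Sum>t. weight t \<xi> * indicator {w} (\<xi> t)) \<in> borel_measurable path_space"
  by (intro borel_measurable_suminf_order borel_measurable_times_ennreal) simp_all

text \<open>
  All likelihood ratios lie below one function, which is integrable by \<open>weighted_visits_le\<close>: writing
  the weight as the sum of its increments leaves a weighted number of visits.
\<close>

lemma weight_le:
  "weight n \<xi> \<le> 1 + ennreal (c\<^sup>2 - 1) * (\<Sum>t. weight t \<xi> * indicator {w} (\<xi> t))"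
proof -
  have "weight n \<xi> = 1 + ennreal (c\<^sup>2 - 1) * (\<Sum>t<n. weight t \<xi> * indicator {w} (\<xi> t))"
  proof (induction n)
    case (Suc n)
    have c2: "ennreal (c\<^sup>2) = 1 + ennreal (c\<^sup>2 - 1)"
      using one_le_c2 by (subst ennreal_1[symmetric], subst ennreal_plus[symmetric]) auto
    have "weight (Suc n) \<xi> = weight n \<xi> + ennreal (c\<^sup>2 - 1) * (weight n \<xi> * indicator {w} (\<xi> n))"
      unfolding weight_def by (simp add: c2 distrib_left distrib_right mult.commute)
    then show ?case
      by (simp only: sum.lessThan_Suc distrib_left add.assoc[symmetric] Suc.IH[symmetric])
  qed (simp add: weight_def)
  also have "\<dots> \<le> 1 + ennreal (c\<^sup>2 - 1) * (\<Sum>t. weight t \<xi> * indicator {w} (\<xi> t))"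
    by (intro add_left_mono mult_left_mono sum_le_suminf) (auto intro: summableI)
  finally show ?thesis .
qed

lemma nn_integral_weight_bound:
  "(\<integral>\<^sup>+\<xi>. 1 + ennreal (c\<^sup>2 - 1) * (\<Sum>t. weight t \<xi> * indicator {w} (\<xi> t)) \<partial>P) < \<infinity>"
proof -
  let ?D = "\<lambda>t. \<integral>\<^sup>+\<xi>. weight t \<xi> * indicator {w} (\<xi> t) \<partial>P"
  have "(\<integral>\<^sup>+\<xi>. 1 + ennreal (c\<^sup>2 - 1) * (\<Sum>t. weight t \<xi> * indicator {w} (\<xi> t)) \<partial>P)
      = 1 + ennreal (c\<^sup>2 - 1) * (\<Sum>t. ?D t)"
    by (subst nn_integral_add, simp, simp, subst nn_integral_cmult, simp, subst nn_integral_suminf)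
      (simp_all add: borel_measurable_times_ennreal)
  moreover have "ennreal \<kappa> * (\<Sum>t. ?D t) \<le> green K w s"
  proof -
    have "ennreal \<kappa> * (\<Sum>t. ?D t) = (\<Sum>t. ennreal \<kappa> * ?D t)"
      by simp
    also have "\<dots> \<le> green K w s"
    proof (intro suminf_le_const summableI)
      fix n
      show "(\<Sum>t<n. ennreal \<kappa> * ?D t) \<le> green K w s"
        unfolding sum_distrib_left[symmetric] weight_def by (rule weighted_visits_le[OF green_gap])
    qed
    finally show ?thesis .
  qed
  then have "(\<Sum>t. ?D t) \<noteq> \<top>"
    using green_finite \<kappa>_pos by (auto simp: ennreal_mult_top top_unique)
  ultimately show ?thesis
    by (simp add: ennreal_mult_less_top less_top)
qed

lemma nn_integral_LR:
  assumes dep: "depends_upto n f" and le: "\<And>\<xi>. f \<xi> \<le> 1"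
  shows "(\<integral>\<^sup>+\<xi>. f \<xi> * ennreal (LR \<xi>) \<partial>P) = (\<integral>\<^sup>+\<xi>. f \<xi> * ennreal (lr n \<xi>) \<partial>P)"
proof -
  note [measurable] = measurable_depends_upto[OF dep]
  have "(\<lambda>m. \<integral>\<^sup>+\<xi>. f \<xi> * ennreal (lr m \<xi>) \<partial>P) \<longlonglongrightarrow> (\<integral>\<^sup>+\<xi>. f \<xi> * ennreal (LR \<xi>) \<partial>P)"
  proof (rule nn_integral_dominated_convergence[OF _ _ _ _ nn_integral_weight_bound])
    show "AE \<xi> in P. f \<xi> * ennreal (lr m \<xi>) \<le> 1 + ennreal (c\<^sup>2 - 1) * (\<Sum>t. weight t \<xi> * indicator {w} (\<xi> t))" for m
    proof (intro AE_I2)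
      fix \<xi>
      have "f \<xi> * ennreal (lr m \<xi>) \<le> 1 * weight m \<xi>"
        by (intro mult_mono le lr_le_weight) auto
      also have "\<dots> \<le> 1 + ennreal (c\<^sup>2 - 1) * (\<Sum>t. weight t \<xi> * indicator {w} (\<xi> t))"
        using weight_le by simp
      finally show "f \<xi> * ennreal (lr m \<xi>) \<le> 1 + ennreal (c\<^sup>2 - 1) * (\<Sum>t. weight t \<xi> * indicator {w} (\<xi> t))" .
    qed
    show "AE \<xi> in P. (\<lambda>m. f \<xi> * ennreal (lr m \<xi>)) \<longlonglongrightarrow> f \<xi> * ennreal (LR \<xi>)"
      using AE_lr_tendsto
    proof eventually_elim
      case (elim \<xi>)
      have "f \<xi> \<noteq> \<top>" using le[of \<xi>] by (auto simp: top_unique)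
      then show ?case
        by (intro ennreal_tendsto_cmult tendsto_ennrealI elim) (simp add: less_top)
    qed
  qed simp_all
  moreover have "(\<lambda>m. \<integral>\<^sup>+\<xi>. f \<xi> * ennreal (lr m \<xi>) \<partial>P) \<longlonglongrightarrow> (\<integral>\<^sup>+\<xi>. f \<xi> * ennreal (lr n \<xi>) \<partial>P)"
    by (intro tendsto_eventually eventually_sequentiallyI[of n] nn_integral_lr_extend[OF dep])
  ultimately show ?thesis by (rule LIMSEQ_unique)
qed

lemma emeasure_perturbed_cylinder:
  "emeasure (path_law (K(w := \<theta>)) s) (cylinder n x) = ennreal (lr n x) * emeasure P (cylinder n x)"
proof -
  have "(\<Prod>i<n. pmf ((K(w := \<theta>)) (x i)) (x (Suc i))) = lr n x * (\<Prod>i<n. pmf (K (x i)) (x (Suc i)))"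
    unfolding lr_def prod.distrib[symmetric] by (intro prod.cong) (auto simp: pmf_perturbed)
  then show ?thesis
    unfolding cylinder_def emeasure_path_law_cylinder
    by (simp add: ennreal_mult' lr_nonneg prod_nonneg del: fun_upd_apply)
qed

lemma nn_integral_perturbed:
  assumes dep: "depends_upto n f"
  shows "(\<integral>\<^sup>+\<xi>. f \<xi> \<partial>path_law (K(w := \<theta>)) s) = (\<integral>\<^sup>+\<xi>. f \<xi> * ennreal (lr n \<xi>) \<partial>P)"
proof -
  have "(\<integral>\<^sup>+\<xi>. indicator (cylinder n x) \<xi> * ennreal (lr n \<xi>) \<partial>P)
      = ennreal (lr n x) * emeasure P (cylinder n x)" for x
  proof -
    have "(\<integral>\<^sup>+\<xi>. indicator (cylinder n x) \<xi> * ennreal (lr n \<xi>) \<partial>P)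
        = (\<integral>\<^sup>+\<xi>. ennreal (lr n x) * indicator (cylinder n x) \<xi> \<partial>P)"
    proof (intro nn_integral_cong)
      fix \<xi> :: "nat \<Rightarrow> 's"
      have "lr n \<xi> = lr n x" if "\<xi> \<in> cylinder n x"
        using that by (intro depends_uptoD[OF depends_upto_lr]) (simp add: cylinder_def)
      then show "indicator (cylinder n x) \<xi> * ennreal (lr n \<xi>) = ennreal (lr n x) * indicator (cylinder n x) \<xi>"
        by (cases "\<xi> \<in> cylinder n x") simp_all
    qed
    then show ?thesis by (simp add: nn_integral_cmult_indicator)
  qed
  then show ?thesis
    using nn_integral_depends_upto[OF dep, of "\<lambda>_. 1" "K(w := \<theta>)" s]
    by (simp add: nn_integral_depends_upto[OF dep] emeasure_perturbed_cylinder del: fun_upd_apply)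
qed

text \<open>
  The perturbed chain is absolutely continuous on whole infinite paths, not only on finite prefixes.
  Dominated convergence keeps the mass of the likelihood ratio from being lost in the limit, so both
  measures agree on cylinder sets.
\<close>

lemma path_law_perturbed: "path_law (K(w := \<theta>)) s = density P (\<lambda>\<xi>. ennreal (LR \<xi>))"
proof (rule measure_eqI_PiM_infinite)
  interpret prob_space "path_law (K(w := \<theta>)) s" by (rule prob_space_path_law)
  show "finite_measure (path_law (K(w := \<theta>)) s)" by unfold_locales
  fix A :: "nat \<Rightarrow> 's set" and J :: "nat set"
  assume J: "finite J"
  let ?A = "prod_emb UNIV (\<lambda>_. count_space UNIV) J (PiE J A)"
  have A_eq: "?A = {\<xi>. \<forall>j\<in>J. \<xi> j \<in> A j}"
    by (auto simp: prod_emb_def space_PiM PiE_iff extensional_def)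
  have [measurable]: "?A \<in> sets path_space"
    using J by (intro sets_PiM_I) auto
  obtain n where n: "J \<subseteq> {..n}"
    using J by (meson finite_nat_iff_bounded_le)
  have dep: "depends_upto n (indicator ?A :: _ \<Rightarrow> ennreal)"
    unfolding A_eq using n by (intro depends_uptoI) (auto simp: indicator_def subset_iff)
  have "emeasure (path_law (K(w := \<theta>)) s) ?A = (\<integral>\<^sup>+\<xi>. indicator ?A \<xi> \<partial>path_law (K(w := \<theta>)) s)"
    by (rule nn_integral_indicator[symmetric]) (simp del: fun_upd_apply)
  also have "\<dots> = (\<integral>\<^sup>+\<xi>. indicator ?A \<xi> * ennreal (LR \<xi>) \<partial>P)"
    unfolding nn_integral_perturbed[OF dep] by (rule nn_integral_LR[OF dep, symmetric]) (simp add: indicator_def)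
  also have "\<dots> = emeasure (density P (\<lambda>\<xi>. ennreal (LR \<xi>))) ?A"
    by (subst emeasure_density) (simp_all add: mult.commute)
  finally show "emeasure (path_law (K(w := \<theta>)) s) ?A = emeasure (density P (\<lambda>\<xi>. ennreal (LR \<xi>))) ?A" .
qed simp_all

lemma chi_square_LR: "ennreal \<kappa> * (\<integral>\<^sup>+\<xi>. ennreal ((LR \<xi> - 1)\<^sup>2) \<partial>P) \<le> ennreal chi2 * green K w s"
proof -
  let ?C = "ennreal chi2 * green K w s"
  have "ennreal \<kappa> * (\<integral>\<^sup>+\<xi>. ennreal ((LR \<xi> - 1)\<^sup>2) \<partial>P) = (\<integral>\<^sup>+\<xi>. ennreal \<kappa> * ennreal ((LR \<xi> - 1)\<^sup>2) \<partial>P)"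
    by (rule nn_integral_cmult[symmetric]) simp
  also have "\<dots> = (\<integral>\<^sup>+\<xi>. liminf (\<lambda>n. ennreal \<kappa> * ennreal ((lr n \<xi> - 1)\<^sup>2)) \<partial>P)"
  proof (intro nn_integral_cong_AE, use AE_lr_tendsto in eventually_elim)
    case (elim \<xi>)
    then have "(\<lambda>n. ennreal \<kappa> * ennreal ((lr n \<xi> - 1)\<^sup>2)) \<longlonglongrightarrow> ennreal \<kappa> * ennreal ((LR \<xi> - 1)\<^sup>2)"
      by (intro ennreal_tendsto_cmult tendsto_ennrealI tendsto_intros) simp
    then show ?case
      by (simp add: lim_imp_Liminf)
  qed
  also have "\<dots> \<le> liminf (\<lambda>n. \<integral>\<^sup>+\<xi>. ennreal \<kappa> * ennreal ((lr n \<xi> - 1)\<^sup>2) \<partial>P)"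
    by (rule nn_integral_liminf) simp
  also have "\<dots> = liminf (\<lambda>n. ennreal \<kappa> * (\<integral>\<^sup>+\<xi>. ennreal ((lr n \<xi> - 1)\<^sup>2) \<partial>P))"
    by (simp add: nn_integral_cmult)
  also have "\<dots> \<le> liminf (\<lambda>n::nat. ?C)"
    by (intro Liminf_mono always_eventually allI chi_square_lr)
  also have "\<dots> = ?C" by (simp add: Liminf_const)
  finally show ?thesis .
qed

text \<open>
  The inequality of Hammersley, Chapman and Robbins: the change of the mean of \<open>f\<close> is its covariance
  with \<open>LR - 1\<close>, to which Cauchy--Schwarz applies. Since it compares two parameters at a
  finite distance, no derivative has to be exchanged with an integral.
\<close>

lemma chapman_robbins:
  assumes f: "integrable P f" and f': "integrable (path_law (K(w := \<theta>)) s) f"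
  defines "\<mu> \<equiv> (\<integral>\<xi>. f \<xi> \<partial>P)"
  shows "ennreal \<kappa> * ennreal (((\<integral>\<xi>. f \<xi> \<partial>path_law (K(w := \<theta>)) s) - \<mu>)\<^sup>2)
       \<le> ennreal chi2 * green K w s * (\<integral>\<^sup>+\<xi>. ennreal ((f \<xi> - \<mu>)\<^sup>2) \<partial>P)"
proof -
  interpret P: prob_space P by (rule prob_space_path_law)
  interpret P': prob_space "path_law (K(w := \<theta>)) s" by (rule prob_space_path_law)
  have fm [measurable]: "f \<in> borel_measurable path_space"
    using borel_measurable_integrable[OF f] by simp
  have dens: "integrable P (\<lambda>\<xi>. LR \<xi> * g \<xi>)"
      "(\<integral>\<xi>. g \<xi> \<partial>path_law (K(w := \<theta>)) s) = (\<integral>\<xi>. LR \<xi> * g \<xi> \<partial>P)"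
    if "integrable (path_law (K(w := \<theta>)) s) g" and [measurable]: "g \<in> borel_measurable path_space" for g :: "_ \<Rightarrow> real"
    using that(1) AE_LR_nonneg unfolding path_law_perturbed
    by (simp_all add: integrable_density integral_density)
  have L: "integrable P LR" "(\<integral>\<xi>. LR \<xi> \<partial>P) = 1"
    using dens[of "\<lambda>_. 1"] P'.prob_space by (simp_all del: fun_upd_apply)
  note Lf = dens[OF f' fm]
  have "(\<integral>\<xi>. (LR \<xi> - 1) * (f \<xi> - \<mu>) \<partial>P) = (\<integral>\<xi>. LR \<xi> * f \<xi> - \<mu> * LR \<xi> - f \<xi> + \<mu> \<partial>P)"
    by (intro Bochner_Integration.integral_cong) (auto simp: algebra_simps)
  also have "\<dots> = (\<integral>\<xi>. f \<xi> \<partial>path_law (K(w := \<theta>)) s) - \<mu>"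
    using L Lf f P.prob_space by (simp add: \<mu>_def)
  finally have "ennreal \<bar>(\<integral>\<xi>. f \<xi> \<partial>path_law (K(w := \<theta>)) s) - \<mu>\<bar> = ennreal \<bar>\<integral>\<xi>. (LR \<xi> - 1) * (f \<xi> - \<mu>) \<partial>P\<bar>"
    by simp
  also have "\<dots> \<le> (\<integral>\<^sup>+\<xi>. ennreal \<bar>LR \<xi> - 1\<bar> * ennreal \<bar>f \<xi> - \<mu>\<bar> \<partial>P)"
  proof -
    have "integrable P (\<lambda>\<xi>. LR \<xi> * f \<xi> - \<mu> * LR \<xi> - f \<xi> + \<mu>)"
      using L Lf f by simp
    then have "integrable P (\<lambda>\<xi>. (LR \<xi> - 1) * (f \<xi> - \<mu>))"
      by (simp add: algebra_simps)
    from integral_norm_bound_ennreal[OF this] show ?thesis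
      by (simp add: abs_mult ennreal_mult')
  qed
  finally have "(ennreal \<bar>(\<integral>\<xi>. f \<xi> \<partial>path_law (K(w := \<theta>)) s) - \<mu>\<bar>)\<^sup>2
      \<le> (\<integral>\<^sup>+\<xi>. ennreal \<bar>LR \<xi> - 1\<bar> * ennreal \<bar>f \<xi> - \<mu>\<bar> \<partial>P)\<^sup>2"
    by (intro power_mono) auto
  also have "\<dots> \<le> (\<integral>\<^sup>+\<xi>. (ennreal \<bar>LR \<xi> - 1\<bar>)\<^sup>2 \<partial>P) * (\<integral>\<^sup>+\<xi>. (ennreal \<bar>f \<xi> - \<mu>\<bar>)\<^sup>2 \<partial>P)"
    by (rule Cauchy_Schwarz_nn_integral) simp_all
  finally have "ennreal (((\<integral>\<xi>. f \<xi> \<partial>path_law (K(w := \<theta>)) s) - \<mu>)\<^sup>2)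
      \<le> (\<integral>\<^sup>+\<xi>. ennreal ((LR \<xi> - 1)\<^sup>2) \<partial>P) * (\<integral>\<^sup>+\<xi>. ennreal ((f \<xi> - \<mu>)\<^sup>2) \<partial>P)"
    by (simp add: ennreal_power)
  from mult_left_mono[OF this, of "ennreal \<kappa>"] mult_right_mono[OF chi_square_LR, of "\<integral>\<^sup>+\<xi>. ennreal ((f \<xi> - \<mu>)\<^sup>2) \<partial>P"]
  show ?thesis
    by (simp add: mult.assoc)
qed

end


section \<open>The bound for one transition probability\<close>

definition mixture :: "real \<Rightarrow> 's \<Rightarrow> 's pmf \<Rightarrow> 's pmf" where
  "mixture \<epsilon> q p = bind_pmf (bernoulli_pmf \<epsilon>) (\<lambda>b. if b then return_pmf q else p)"

lemma pmf_mixture: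
  assumes "0 \<le> \<epsilon>" "\<epsilon> \<le> 1"
  shows "pmf (mixture \<epsilon> q p) y = (1 - \<epsilon>) * pmf p y + \<epsilon> * indicator {q} y"
  using assms by (auto simp: mixture_def pmf_bind indicator_def)

lemma set_pmf_mixture: "set_pmf (mixture \<epsilon> q p) \<subseteq> insert q (set_pmf p)"
  by (auto simp: mixture_def split: if_splits)

text \<open>
  Moving the row from \<open>p\<close> towards the point mass at \<open>q\<close> is the direction in which the bound for the
  single coordinate \<open>q\<close> is sharp. For the mixture with weight \<open>\<epsilon>\<close> the mean of \<open>f\<close> changes by
  \<open>\<epsilon> (1 - p q)\<close> and the chi-square divergence is \<open>\<epsilon>\<^sup>2 (1 - p q) / p q\<close>. The powers of \<open>\<epsilon>\<close> cancel in
  \<open>chapman_robbins\<close>, and \<open>\<epsilon> \<rightarrow> 0\<close> turns \<open>\<kappa>\<close> into \<open>1\<close>. Only rows supported by the original row occur,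
  which keeps the laws absolutely continuous even if the original row lies on the boundary of the
  parameter space.
\<close>

lemma cramer_rao_coordinate:
  fixes K :: "'s::finite \<Rightarrow> 's pmf" and f :: "(nat \<Rightarrow> 's) \<Rightarrow> real"
  assumes p: "0 < pmf (K w) q" "pmf (K w) q < 1"
    and fin: "green K w s \<noteq> \<infinity>" and reach: "visit_prob K w t s \<noteq> 0"
    and int: "\<And>\<theta>. set_pmf \<theta> \<subseteq> set_pmf (K w) \<Longrightarrow> integrable (path_law (K(w := \<theta>)) s) f"
    and unbiased: "\<And>\<theta>. set_pmf \<theta> \<subseteq> set_pmf (K w) \<Longrightarrow> (\<integral>\<xi>. f \<xi> \<partial>path_law (K(w := \<theta>)) s) = pmf \<theta> q"
  shows "ennreal (pmf (K w) q * (1 - pmf (K w) q))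
       \<le> (\<integral>\<^sup>+\<xi>. ennreal ((f \<xi> - pmf (K w) q)\<^sup>2) \<partial>path_law K s) * green K w s"
proof -
  define p where "p = pmf (K w) q"
  define V where "V = (\<integral>\<^sup>+\<xi>. ennreal ((f \<xi> - p)\<^sup>2) \<partial>path_law K s)"
  define G where "G = enn2real (green K w w)"
  have p01: "0 < p" "p < 1" using p by (simp_all add: p_def)
  have "green K w w \<noteq> \<top>"
    using visit_prob_mult_green_le[of K w t s] fin reach by (auto simp: ennreal_mult_top top_unique)
  then have G: "green K w w = ennreal G" by (simp add: G_def less_top)
  have first: "1 + (\<integral>\<^sup>+y. green K w y \<partial>K w) = ennreal G"
    using green_first_step[of K w w] G by simp
  have "1 \<le> ennreal G" unfolding first[symmetric] by simp
  then have G1: "1 \<le> G" using ennreal_le_iff2[of 1 G] by simp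
  have "1 + (\<integral>\<^sup>+y. green K w y \<partial>K w) = 1 + ennreal (G - 1)"
    unfolding first using G1 by (subst ennreal_1[symmetric], subst ennreal_plus[symmetric]) auto
  then have after: "(\<integral>\<^sup>+y. green K w y \<partial>K w) = ennreal (G - 1)"
    by (simp add: ennreal_add_left_cancel)
  have mean: "integrable (path_law K s) f" "(\<integral>\<xi>. f \<xi> \<partial>path_law K s) = p"
    using int[of "K w"] unbiased[of "K w"] by (simp_all add: p_def)
  \<comment> \<open>\<open>c \<epsilon>\<close> is the largest likelihood ratio of a single step, attained at \<open>q\<close>, and \<open>\<kappa> \<epsilon>\<close> is the largest
    gap it admits\<close>
  define c where "c \<epsilon> = 1 - \<epsilon> + \<epsilon> / p" for \<epsilon>
  define \<kappa> where "\<kappa> \<epsilon> = G - (c \<epsilon>)\<^sup>2 * (G - 1)" for \<epsilon>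
  have bound: "ennreal (\<kappa> \<epsilon> * (1 - p)\<^sup>2) \<le> ennreal ((1 - p) / p) * green K w s * V"
    if \<epsilon>: "0 < \<epsilon>" "\<epsilon> < 1" for \<epsilon>
  proof (cases "\<kappa> \<epsilon> \<le> 0")
    case True
    then show ?thesis by (simp add: ennreal_neg mult_nonpos_nonneg)
  next
    case False
    define \<theta> where "\<theta> = mixture \<epsilon> q (K w)"
    define r where "r y = (if y = q then c \<epsilon> else 1 - \<epsilon>)" for y
    have c1: "1 \<le> c \<epsilon>" using \<epsilon> p01 by (simp add: c_def field_simps)
    interpret row_perturbation K s w \<theta> r "c \<epsilon>" "\<kappa> \<epsilon>"
    proof
      show "pmf \<theta> y = pmf (K w) y * r y" for y
        using \<epsilon> p01 by (auto simp: \<theta>_def r_def c_def pmf_mixture p_def[symmetric] field_simps)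
      show "0 \<le> r y" "r y \<le> c \<epsilon>" for y
        using \<epsilon> c1 by (auto simp: r_def)
      have "ennreal ((c \<epsilon>)\<^sup>2) * ennreal (G - 1) + ennreal (\<kappa> \<epsilon>) = ennreal G"
        using G1 False by (simp add: ennreal_mult'[symmetric] ennreal_plus[symmetric] \<kappa>_def del: ennreal_plus)
      then show "ennreal ((c \<epsilon>)\<^sup>2) * (\<integral>\<^sup>+y. green K w y \<partial>K w) + ennreal (\<kappa> \<epsilon>) \<le> green K w w"
        by (simp add: after G)
    qed (use c1 False fin in auto)
    have supp: "set_pmf \<theta> \<subseteq> set_pmf (K w)"
      using set_pmf_mixture[of \<epsilon> q "K w"] p by (auto simp: \<theta>_def set_pmf_iff)
    have \<theta>q: "pmf \<theta> q - p = \<epsilon> * (1 - p)"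
      using \<epsilon> by (simp add: \<theta>_def pmf_mixture p_def algebra_simps)
    have "(\<Sum>y\<in>UNIV. pmf (K w) y * (r y)\<^sup>2)
        = (\<Sum>y\<in>UNIV. (1 - \<epsilon>)\<^sup>2 * pmf (K w) y + (if y = q then p * ((c \<epsilon>)\<^sup>2 - (1 - \<epsilon>)\<^sup>2) else 0))"
      by (intro sum.cong) (auto simp: r_def p_def algebra_simps)
    also have "\<dots> = (1 - \<epsilon>)\<^sup>2 + p * ((c \<epsilon>)\<^sup>2 - (1 - \<epsilon>)\<^sup>2)"
      by (simp add: sum.distrib sum_distrib_left[symmetric] sum_pmf_eq_1)
    also have "\<dots> = 1 + \<epsilon>\<^sup>2 * ((1 - p) / p)"
      using p01 by (simp add: c_def power2_eq_square field_simps)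
    finally have chi: "chi2 = \<epsilon>\<^sup>2 * ((1 - p) / p)" by (simp add: chi2_def)
    have "ennreal (\<epsilon>\<^sup>2) * ennreal (\<kappa> \<epsilon> * (1 - p)\<^sup>2) = ennreal (\<kappa> \<epsilon>) * ennreal ((pmf \<theta> q - p)\<^sup>2)"
      using False unfolding \<theta>q by (simp add: ennreal_mult'[symmetric] power_mult_distrib mult_ac)
    also have "\<dots> \<le> ennreal chi2 * green K w s * V"
      using chapman_robbins[OF mean(1) int[OF supp]] unfolding unbiased[OF supp] mean(2) V_def .
    also have "\<dots> = ennreal (\<epsilon>\<^sup>2) * (ennreal ((1 - p) / p) * green K w s * V)"
      unfolding chi by (subst ennreal_mult') (simp_all only: mult.assoc zero_le_power2)
    finally show ?thesis
      using \<epsilon> by (simp add: ennreal_mult_le_mult_iff)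
  qed
  have "((\<lambda>\<epsilon>. ennreal (\<kappa> \<epsilon> * (1 - p)\<^sup>2)) \<longlongrightarrow> ennreal ((1 - p)\<^sup>2)) (at_right 0)"
  proof (rule tendsto_ennrealI)
    have "((\<lambda>\<epsilon>. \<kappa> \<epsilon> * (1 - p)\<^sup>2) \<longlongrightarrow> (G - (1 - 0 + 0 / p)\<^sup>2 * (G - 1)) * (1 - p)\<^sup>2) (at_right 0)"
      unfolding \<kappa>_def c_def using p01 by (intro tendsto_intros) auto
    then show "((\<lambda>\<epsilon>. \<kappa> \<epsilon> * (1 - p)\<^sup>2) \<longlongrightarrow> (1 - p)\<^sup>2) (at_right 0)" by simp
  qed
  moreover have "eventually (\<lambda>\<epsilon>. ennreal (\<kappa> \<epsilon> * (1 - p)\<^sup>2) \<le> ennreal ((1 - p) / p) * green K w s * V) (at_right 0)"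
    using bound by (intro eventually_at_rightI[of 0 1]) auto
  ultimately have "ennreal ((1 - p)\<^sup>2) \<le> ennreal ((1 - p) / p) * green K w s * V"
    by (rule tendsto_upperbound) simp
  \<comment> \<open>divide by the Fisher information of one transition\<close>
  from mult_left_mono[OF this, of "ennreal (p / (1 - p))"]
  have "ennreal (p / (1 - p) * (1 - p)\<^sup>2) \<le> ennreal (p / (1 - p) * ((1 - p) / p)) * green K w s * V"
    using p01 by (subst (1 2) ennreal_mult') (simp_all add: mult.assoc)
  moreover have "p / (1 - p) * (1 - p)\<^sup>2 = p * (1 - p)" "p / (1 - p) * ((1 - p) / p) = 1"
    using p01 by (simp_all add: power2_eq_square)
  ultimately show ?thesis
    by (simp add: p_def[symmetric] V_def[symmetric] mult.commute)
qed


section \<open>The bound for the total mean squared error\<close>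

text \<open>
  Summing over the coordinates; those with transition probability \<open>0\<close> or \<open>1\<close> contribute \<open>0\<close> to the
  left-hand side.
\<close>

lemma mse_lower_bound:
  fixes M :: "('s::finite, 'a::finite) mdp"
  assumes \<pi>: "\<pi> \<in> stationary_policies M" and est: "unbiased_estimator M \<pi> w est"
    and reach: "reach_prob M \<pi> w \<noteq> 0" and fin: "green (induced M \<pi>) w (init M) \<noteq> \<infinity>"
  shows "(\<Sum>q\<in>succ_states M w. ennreal (pmf (induced M \<pi> w) q * (1 - pmf (induced M \<pi> w) q)))
       \<le> mse M \<pi> w est * green (induced M \<pi>) w (init M)"
proof -
  let ?K = "induced M \<pi>"
  obtain t where t: "visit_prob ?K w t (init M) \<noteq> 0"
    using reach unfolding reach_prob_def by (rule ex_visit_prob_pos)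
  show ?thesis
    unfolding mse_def sum_distrib_right
  proof (rule sum_mono)
    fix q assume q: "q \<in> succ_states M w"
    show "ennreal (pmf (?K w) q * (1 - pmf (?K w) q))
        \<le> (\<integral>\<^sup>+\<xi>. ennreal ((est \<xi> q - pmf (?K w) q)\<^sup>2) \<partial>path_law ?K (init M)) * green ?K w (init M)"
    proof (cases "0 < pmf (?K w) q \<and> pmf (?K w) q < 1")
      case True
      have "set_pmf \<theta> \<subseteq> succ_states M w" if "set_pmf \<theta> \<subseteq> set_pmf (?K w)" for \<theta>
        using that set_pmf_induced[OF \<pi>] by blast
      then show ?thesis
        using True est q unfolding unbiased_estimator_def
        by (intro cramer_rao_coordinate[OF _ _ fin t]) auto
    next
      case False
      then have "pmf (?K w) q = 0 \<or> pmf (?K w) q = 1"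
        using pmf_le_1[of "?K w" q] pmf_nonneg[of "?K w" q] by linarith
      then show ?thesis by auto
    qed
  qed
qed

lemma expected_info_eq:
  fixes M :: "('s::finite, 'a) mdp"
  shows "expected_info M \<pi> W = (\<Sum>w\<in>W. trans_info M \<pi> w * green (induced M \<pi>) w (init M))"
proof -
  have "total_info M \<pi> W \<xi> = (\<Sum>w\<in>W. trans_info M \<pi> w * (\<Sum>t. indicator {w} (\<xi> t)))" for \<xi>
  proof -
    have "(if x \<in> W then trans_info M \<pi> x else 0) = (\<Sum>w\<in>W. trans_info M \<pi> w * indicator {w} x)" for x
      by (simp add: indicator_def sum.delta' if_distrib[of "(*) _"] cong: if_cong)
    then have "total_info M \<pi> W \<xi> = (\<Sum>t. \<Sum>w\<in>W. trans_info M \<pi> w * indicator {w} (\<xi> t))"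
      by (simp add: total_info_def)
    also have "\<dots> = (\<Sum>w\<in>W. \<Sum>t. trans_info M \<pi> w * indicator {w} (\<xi> t))"
      by (rule suminf_sum) (rule summableI)
    finally show ?thesis by simp
  qed
  then show ?thesis
    by (simp add: expected_info_def nn_integral_sum nn_integral_cmult nn_integral_visits)
qed

text \<open>
  The inequality between the arithmetic and the harmonic mean.
\<close>

lemma square_card_le_sum_mult_sum_inverse:
  fixes a :: "'b \<Rightarrow> real"
  assumes "\<And>x. x \<in> A \<Longrightarrow> 0 < a x"
  shows "(real (card A))\<^sup>2 \<le> (\<Sum>x\<in>A. a x) * (\<Sum>x\<in>A. 1 / a x)"
proof -
  have "(\<Sum>x\<in>A. sqrt (a x) * sqrt (1 / a x))\<^sup>2 \<le> (\<Sum>x\<in>A. (sqrt (a x))\<^sup>2) * (\<Sum>x\<in>A. (sqrt (1 / a x))\<^sup>2)"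
    by (rule Cauchy_Schwarz_ineq_sum)
  moreover have "(\<Sum>x\<in>A. sqrt (a x) * sqrt (1 / a x)) = (\<Sum>x\<in>A. 1)"
    using assms by (intro sum.cong refl) (simp add: real_sqrt_mult[symmetric] less_imp_neq[THEN not_sym])
  moreover have "(\<Sum>x\<in>A. (sqrt (a x))\<^sup>2) = (\<Sum>x\<in>A. a x)" "(\<Sum>x\<in>A. (sqrt (1 / a x))\<^sup>2) = (\<Sum>x\<in>A. 1 / a x)"
    using assms by (auto intro!: sum.cong simp: less_imp_le)
  ultimately show ?thesis by simp
qed

text \<open>
  The contribution of \<open>w\<close> to the expected information is \<open>a w\<close>, the expected number of visits divided
  by the variance of one transition, and \<open>mse_lower_bound\<close> says that the error at \<open>w\<close> is at least
  \<open>1 / a w\<close>. If the expected information is infinite, the bound is \<open>0\<close>; otherwise reachability forces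
  every transition variance to be positive and every \<open>a w\<close> to be a positive real number.
\<close>

lemma total_mse_lower_bound:
  fixes M :: "('s::finite, 'a::finite) mdp"
  assumes \<pi>: "\<pi> \<in> stationary_policies M"
    and est: "\<And>w. w \<in> W \<Longrightarrow> unbiased_estimator M \<pi> w (est w)"
    and reach: "\<And>w. w \<in> W \<Longrightarrow> reach_prob M \<pi> w \<noteq> 0"
  shows "ennreal ((real (card W))\<^sup>2) / expected_info M \<pi> W \<le> (\<Sum>w\<in>W. mse M \<pi> w (est w))"
proof (cases "expected_info M \<pi> W = \<top>")
  case True
  then show ?thesis by simp
next
  case False
  let ?K = "induced M \<pi>" and ?g = "\<lambda>w. green (induced M \<pi>) w (init M)"
  define V where "V w = (\<Sum>q\<in>succ_states M w. pmf (?K w) q * (1 - pmf (?K w) q))" for w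
  define a where "a w = enn2real (?g w) / V w" for w
  have V_nonneg: "0 \<le> V w" for w
    unfolding V_def by (intro sum_nonneg mult_nonneg_nonneg) (auto simp: pmf_le_1)
  have V: "(\<Sum>q\<in>succ_states M w. ennreal (pmf (?K w) q * (1 - pmf (?K w) q))) = ennreal (V w)" for w
    unfolding V_def by (intro sum_ennreal mult_nonneg_nonneg) (auto simp: pmf_le_1)
  have *: "0 < a w \<and> trans_info M \<pi> w * ?g w = ennreal (a w) \<and> ennreal (1 / a w) \<le> mse M \<pi> w (est w)"
    if w: "w \<in> W" for w
  proof -
    have info: "trans_info M \<pi> w * ?g w \<noteq> \<top>"
      using False w by (simp add: expected_info_eq)
    obtain t where "visit_prob ?K w t (init M) \<noteq> 0"
      using reach[OF w] unfolding reach_prob_def by (rule ex_visit_prob_pos)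
    then have g0: "?g w \<noteq> 0"
      using green_ge_visit_prob[of ?K w t "init M"] by auto
    have V0: "V w \<noteq> 0"
      using info g0 by (auto simp: trans_info_def V ennreal_top_mult)
    then have Vpos: "0 < V w" using V_nonneg[of w] by linarith
    have ti: "trans_info M \<pi> w = ennreal (1 / V w)"
      using Vpos by (simp add: trans_info_def V inverse_ennreal inverse_eq_divide)
    have gfin: "?g w \<noteq> \<top>"
      using info Vpos by (auto simp: ti ennreal_mult_top)
    then have g: "?g w = ennreal (enn2real (?g w))" by (simp add: less_top)
    have gpos: "0 < enn2real (?g w)"
      using g0 gfin by (simp add: enn2real_positive_iff less_top zero_less_iff_neq_zero)
    have apos: "0 < a w" using gpos Vpos by (simp add: a_def)
    have info_eq: "trans_info M \<pi> w * ?g w = ennreal (a w)"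
      using Vpos unfolding ti by (subst g) (simp add: ennreal_mult'[symmetric] a_def)
    have "ennreal (V w) \<le> mse M \<pi> w (est w) * ?g w"
      using mse_lower_bound[OF \<pi> est[OF w] reach[OF w]] gfin by (simp add: V)
    then have le: "ennreal (V w) \<le> mse M \<pi> w (est w) * ennreal (enn2real (?g w))"
      using g by simp
    have "ennreal (1 / a w) \<le> mse M \<pi> w (est w)"
    proof (cases "mse M \<pi> w (est w)")
      case (real m)
      then show ?thesis
        using le gpos Vpos by (simp add: ennreal_mult'[symmetric] a_def field_simps)
    qed simp
    then show ?thesis using apos info_eq by blast
  qed
  have info: "expected_info M \<pi> W = ennreal (\<Sum>w\<in>W. a w)"
  proof -
    have "expected_info M \<pi> W = (\<Sum>w\<in>W. ennreal (a w))"
      unfolding expected_info_eq using * by (intro sum.cong) auto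
    then show ?thesis using * by (simp add: sum_ennreal less_imp_le)
  qed
  show ?thesis
  proof (cases "W = {}")
    case False
    then have pos: "0 < (\<Sum>w\<in>W. a w)"
      using * by (intro sum_pos) auto
    have "ennreal ((real (card W))\<^sup>2) / expected_info M \<pi> W = ennreal ((real (card W))\<^sup>2 / (\<Sum>w\<in>W. a w))"
      unfolding info using pos by (intro divide_ennreal) auto
    also have "\<dots> \<le> ennreal (\<Sum>w\<in>W. 1 / a w)"
      using square_card_le_sum_mult_sum_inverse[of W a] pos *
      by (intro ennreal_leI) (simp add: divide_le_eq mult.commute)
    also have "\<dots> = (\<Sum>w\<in>W. ennreal (1 / a w))"
      using * by (simp add: sum_ennreal less_imp_le)
    also have "\<dots> \<le> (\<Sum>w\<in>W. mse M \<pi> w (est w))"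
      using * by (intro sum_mono) auto
    finally show ?thesis .
  qed simp
qed

theorem corollary5:
  fixes M :: "('s::finite, 'a::finite) mdp"
    and W :: "'s set"
    and \<pi> :: "'s \<Rightarrow> 'a pmf"
    and est :: "'s \<Rightarrow> (nat \<Rightarrow> 's) \<Rightarrow> 's \<Rightarrow> real"
  assumes "W \<noteq> {}"
    and "\<pi> \<in> stationary_policies M"
    and "\<And>w. w \<in> W \<Longrightarrow> unbiased_estimator M \<pi> w (est w)"
  shows "(\<Sum>w\<in>W. mse M \<pi> w (est w)) \<ge>
           ennreal (Min ((\<lambda>w. (reach_prob M \<pi> w)\<^sup>2) ` W) * (real (card W))\<^sup>2) / expected_info M \<pi> W
       \<and> ((\<forall>\<pi>'\<in>stationary_policies M. \<forall>w\<in>W. reach_prob M \<pi>' w = 1) \<longrightarrow>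
          (\<Sum>w\<in>W. mse M \<pi> w (est w)) \<ge> ennreal ((real (card W))\<^sup>2) / expected_info M \<pi> W)"
proof
  let ?m = "Min ((\<lambda>w. (reach_prob M \<pi> w)\<^sup>2) ` W)"
  show "ennreal (?m * (real (card W))\<^sup>2) / expected_info M \<pi> W \<le> (\<Sum>w\<in>W. mse M \<pi> w (est w))"
  proof (cases "\<exists>w\<in>W. reach_prob M \<pi> w = 0")
    case True
    \<comment> \<open>the numerator vanishes, and \<open>0 / x = 0\<close> in \<^typ>\<open>ennreal\<close> for every \<open>x\<close>, including \<open>0\<close>\<close>
    then have "?m \<le> 0"
      by (auto intro!: Min_le image_eqI)
    then show ?thesis
      by (simp add: ennreal_neg mult_nonpos_nonneg)
  next
    case False
    interpret prob_space "path_law (induced M \<pi>) (init M)" by (rule prob_space_path_law)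
    obtain w where w: "w \<in> W" using assms(1) by blast
    have "?m \<le> (reach_prob M \<pi> w)\<^sup>2"
      using w by (intro Min_le) auto
    also have "\<dots> \<le> 1"
      unfolding reach_prob_def by (intro power_le_one) auto
    finally have "?m * (real (card W))\<^sup>2 \<le> 1 * (real (card W))\<^sup>2"
      by (intro mult_right_mono) auto
    then have "ennreal (?m * (real (card W))\<^sup>2) / expected_info M \<pi> W
        \<le> ennreal ((real (card W))\<^sup>2) / expected_info M \<pi> W"
      by (intro divide_right_mono_ennreal ennreal_leI) simp
    also have "\<dots> \<le> (\<Sum>w\<in>W. mse M \<pi> w (est w))"
      using assms False by (intro total_mse_lower_bound) auto
    finally show ?thesis .
  qed
  show "(\<forall>\<pi>'\<in>stationary_policies M. \<forall>w\<in>W. reach_prob M \<pi>' w = 1) \<longrightarrow>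
      ennreal ((real (card W))\<^sup>2) / expected_info M \<pi> W \<le> (\<Sum>w\<in>W. mse M \<pi> w (est w))"
    using assms by (intro impI total_mse_lower_bound) auto
qed

end
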